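(* Let $L$ be a del Pezzo lattice of rank $n\geq 4$ (so $4\leq n\leq 8$). The reduction map $\rho:\operatorname{O}(L)\rightarrow\operatorname{O}(L_2)$ induces an isomorphism of $\operatorname{O}(L)/\{\pm 1\}$ onto $\operatorname{O}(L_2)$.
   Context: Del Pezzo lattices: for $3\leq n\leq 8$, let $L_0$ be the free $\mathbb{Z}$-module with basis $E_0,\ldots,E_n$, endowed with the symmetric bilinear form defined by $E_0^2=-1$, $E_i^2=1$ for $i\geq 1$, and $(E_i\cdot E_j)=0$ for $i\neq j$. Let $K=3E_0-\sum_{i\geq 1}E_i$. The del Pezzo lattice of rank $n$ is $L=K^{\perp}\subset L_0$; it is an even lattice (positive definite, of rank $n$). The vectors of square $2$ in $L$ form a root system, of type $A_1\times A_2, A_4, D_5, E_6, E_7, E_8$ for $n=3,4,5,6,7,8$ respectively. Reduction mod. $2$: $L_2:=L/2L$ is an $\mathbb{F}_2$-vector space, equipped with the quadratic form $q:L_2\to\mathbb{F}_2$ deduced from $v\mapsto \frac{1}{2}v^2$ on $L$. $\operatorname{O}(L)$ is the group of automorphisms of the $\mathbb{Z}$-module $L$ preserving the scalar product, $\operatorname{O}(L_2)$ is the group of $\mathbb{F}_2$-linear automorphisms of $L_2$ preserving $q$, and $\rho:\operatorname{O}(L)\to\operatorname{O}(L_2)$ is the homomorphism sending an isometry of $L$ to the automorphism it induces on $L/2L$. *)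

theory Defs
  imports "HOL-Algebra.Bij" "HOL-Algebra.Free_Abelian_Groups" "HOL-Library.Z2"
begin

text \<open>The ambient lattice is \<^term>\<open>free_Abelian_group {0..n}\<close>, with basis vectors
  \<^term>\<open>frag_of i\<close>; it carries the form with Gram matrix diag(-1, 1, ..., 1).\<close>

definition dP_form :: "nat \<Rightarrow> (nat \<Rightarrow>\<^sub>0 int) \<Rightarrow> (nat \<Rightarrow>\<^sub>0 int) \<Rightarrow> int" where
  "dP_form n v w =
     - (Poly_Mapping.lookup v 0 * Poly_Mapping.lookup w 0)
     + (\<Sum>i=1..n. Poly_Mapping.lookup v i * Poly_Mapping.lookup w i)"

definition dP_K :: "nat \<Rightarrow> (nat \<Rightarrow>\<^sub>0 int)" where
  "dP_K n = frag_cmul 3 (frag_of 0) - (\<Sum>i=1..n. frag_of i)"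

definition del_Pezzo_lattice :: "nat \<Rightarrow> (nat \<Rightarrow>\<^sub>0 int) monoid" where
  "del_Pezzo_lattice n = (free_Abelian_group {0..n})
     \<lparr>carrier := {v \<in> carrier (free_Abelian_group {0..n}). dP_form n v (dP_K n) = 0}\<rparr>"

definition dP_double :: "nat \<Rightarrow> (nat \<Rightarrow>\<^sub>0 int) set" where
  "dP_double n = frag_cmul 2 ` carrier (del_Pezzo_lattice n)"

definition dP_mod2 :: "nat \<Rightarrow> (nat \<Rightarrow>\<^sub>0 int) set monoid" where
  "dP_mod2 n = del_Pezzo_lattice n Mod dP_double n"

definition dP_mod2_scale :: "nat \<Rightarrow> bit \<Rightarrow> (nat \<Rightarrow>\<^sub>0 int) set \<Rightarrow> (nat \<Rightarrow>\<^sub>0 int) set" where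
  "dP_mod2_scale n c X = (if c = 0 then \<one>\<^bsub>dP_mod2 n\<^esub> else X)"

text \<open>The set of values taken on a coset is a singleton: see \<open>dP_quad_coset\<close> below.\<close>

definition dP_quad :: "nat \<Rightarrow> (nat \<Rightarrow>\<^sub>0 int) set \<Rightarrow> bit" where
  "dP_quad n X = the_elem ((\<lambda>v. of_int (dP_form n v v div 2)) ` X)"

definition dP_O :: "nat \<Rightarrow> ((nat \<Rightarrow>\<^sub>0 int) \<Rightarrow> (nat \<Rightarrow>\<^sub>0 int)) monoid" where
  "dP_O n = (AutoGroup (del_Pezzo_lattice n))
     \<lparr>carrier := {f \<in> auto (del_Pezzo_lattice n).
        \<forall>v \<in> carrier (del_Pezzo_lattice n). \<forall>w \<in> carrier (del_Pezzo_lattice n).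
          dP_form n (f v) (f w) = dP_form n v w}\<rparr>"

definition dP_O_mod2 ::
    "nat \<Rightarrow> ((nat \<Rightarrow>\<^sub>0 int) set \<Rightarrow> (nat \<Rightarrow>\<^sub>0 int) set) monoid" where
  "dP_O_mod2 n = (AutoGroup (dP_mod2 n))
     \<lparr>carrier := {g \<in> auto (dP_mod2 n). \<forall>X \<in> carrier (dP_mod2 n).
        (\<forall>c. g (dP_mod2_scale n c X) = dP_mod2_scale n c (g X)) \<and>
        dP_quad n (g X) = dP_quad n X}\<rparr>"

text \<open>An automorphism of the lattice maps the coset of \<open>v\<close> onto the coset of its value at \<open>v\<close>,
  so the induced map on the quotient is the direct image; see \<open>dP_rho_coset\<close>.\<close>

definition dP_rho ::
    "nat \<Rightarrow> ((nat \<Rightarrow>\<^sub>0 int) \<Rightarrow> (nat \<Rightarrow>\<^sub>0 int)) \<Rightarrow> (nat \<Rightarrow>\<^sub>0 int) set \<Rightarrow> (nat \<Rightarrow>\<^sub>0 int) set" where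
  "dP_rho n f = (\<lambda>X \<in> carrier (dP_mod2 n). f ` X)"

definition dP_pm1 :: "nat \<Rightarrow> ((nat \<Rightarrow>\<^sub>0 int) \<Rightarrow> (nat \<Rightarrow>\<^sub>0 int)) set" where
  "dP_pm1 n = {\<one>\<^bsub>dP_O n\<^esub>, (\<lambda>v \<in> carrier (del_Pezzo_lattice n). - v)}"

abbreviation "dP_L n \<equiv> carrier (del_Pezzo_lattice n)"

lemma dP_form_add_left: "dP_form n (u + v) w = dP_form n u w + dP_form n v w"
  by (simp add: dP_form_def lookup_add algebra_simps sum.distrib)

lemma dP_form_sym: "dP_form n v w = dP_form n w v"
  by (simp add: dP_form_def mult.commute)

lemma dP_form_add_right: "dP_form n w (u + v) = dP_form n w u + dP_form n w v"
  by (metis dP_form_add_left dP_form_sym)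

lemma dP_form_cmul_left: "dP_form n (frag_cmul k v) w = k * dP_form n v w"
  by (simp add: dP_form_def algebra_simps sum_distrib_left)

lemma dP_form_cmul_right: "dP_form n w (frag_cmul k v) = k * dP_form n w v"
  by (metis dP_form_cmul_left dP_form_sym)

lemma dP_form_minus_left: "dP_form n (- v) w = - dP_form n v w"
  by (simp add: dP_form_def sum_negf)

lemma dP_form_minus_right: "dP_form n w (- v) = - dP_form n w v"
  by (metis dP_form_minus_left dP_form_sym)

lemma dP_form_zero_left: "dP_form n 0 w = 0"
  by (simp add: dP_form_def)

lemma dP_form_basis:
  assumes "i \<le> n" "j \<le> n"
  shows "dP_form n (frag_of i) (frag_of j) = (if i \<noteq> j then 0 else if i = 0 then -1 else 1)"
proof -
  have eq: "Poly_Mapping.lookup (frag_of i) k * Poly_Mapping.lookup (frag_of j) k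
      = (if k = i then if i = j then 1 else 0 else (0::int))" for k
    by (auto simp: lookup_single when_def)
  show ?thesis
    unfolding dP_form_def eq using assms by (auto simp: sum.delta)
qed

lemma lookup_dP_K:
  "Poly_Mapping.lookup (dP_K n) i = (if i = 0 then 3 else if i \<le> n then -1 else 0)"
proof -
  have "Poly_Mapping.lookup (\<Sum>i=1..n. frag_of i) i = (\<Sum>k=1..n. if k = i then 1 else 0 :: int)"
    unfolding lookup_sum by (rule sum.cong) (auto simp: lookup_single when_def)
  then show ?thesis
    by (auto simp: dP_K_def lookup_minus lookup_single when_def simp del: single_one)
qed

lemma del_Pezzo_lattice_simps [simp]:
  "v \<otimes>\<^bsub>del_Pezzo_lattice n\<^esub> w = v + w" "\<one>\<^bsub>del_Pezzo_lattice n\<^esub> = 0"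
  by (simp_all add: del_Pezzo_lattice_def)

lemma dP_L_iff: "v \<in> dP_L n \<longleftrightarrow> Poly_Mapping.keys v \<subseteq> {0..n} \<and> dP_form n v (dP_K n) = 0"
  by (simp add: del_Pezzo_lattice_def)

lemma dP_L_zero: "0 \<in> dP_L n"
  by (simp add: dP_L_iff dP_form_zero_left)

lemma dP_L_add: "v \<in> dP_L n \<Longrightarrow> w \<in> dP_L n \<Longrightarrow> v + w \<in> dP_L n"
  using keys_add[of v w] by (auto simp: dP_L_iff dP_form_add_left)

lemma dP_L_minus: "v \<in> dP_L n \<Longrightarrow> - v \<in> dP_L n"
  by (simp add: dP_L_iff dP_form_minus_left)

lemma comm_group_del_Pezzo: "comm_group (del_Pezzo_lattice n)"
  by (rule comm_groupI)
     (auto simp: dP_L_zero dP_L_add add.assoc add.commute intro!: bexI[where x = "- _"] dP_L_minus)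

lemma dP_form_even:
  assumes "v \<in> dP_L n"
  shows "even (dP_form n v v)"
proof -
  let ?x = "Poly_Mapping.lookup v"
  have "dP_form n v (dP_K n) = - 3 * ?x 0 - (\<Sum>i=1..n. ?x i)"
    by (simp add: dP_form_def lookup_dP_K sum_negf)
  with assms have K: "(\<Sum>i=1..n. ?x i) = - 3 * ?x 0"
    by (simp add: dP_L_iff)
  have "even (\<Sum>i=1..n. ?x i * ?x i - ?x i)"
    by (rule dvd_sum) simp
  then have "even ((\<Sum>i=1..n. ?x i * ?x i) - (\<Sum>i=1..n. ?x i))"
    by (simp add: sum_subtractf)
  then show ?thesis
    unfolding dP_form_def K by auto
qed

lemma dP_double_iff: "x \<in> dP_double n \<longleftrightarrow> (\<exists>u \<in> dP_L n. x = frag_cmul 2 u)"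
  unfolding dP_double_def by auto

lemma dP_L_cmul: "v \<in> dP_L n \<Longrightarrow> frag_cmul k v \<in> dP_L n"
  using keys_cmul[of k v] by (auto simp: dP_L_iff dP_form_cmul_left)

lemma subgroup_dP_double: "subgroup (dP_double n) (del_Pezzo_lattice n)"
proof -
  interpret comm_group "del_Pezzo_lattice n" by (rule comm_group_del_Pezzo)
  have inv_eq: "inv\<^bsub>del_Pezzo_lattice n\<^esub> v = - v" if "v \<in> dP_L n" for v
    by (rule inv_equality) (use that dP_L_minus in auto)
  show ?thesis
  proof (rule subgroupI)
    show "dP_double n \<subseteq> dP_L n"
      by (auto simp: dP_double_iff dP_L_cmul)
    show "dP_double n \<noteq> {}"
      using dP_L_zero by (auto simp: dP_double_def)
  next
    fix x assume "x \<in> dP_double n"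
    then obtain u where u: "u \<in> dP_L n" "x = frag_cmul 2 u"
      by (auto simp: dP_double_iff)
    then have "inv\<^bsub>del_Pezzo_lattice n\<^esub> x = frag_cmul 2 (- u)"
      by (simp add: inv_eq dP_L_cmul poly_mapping_eqI)
    with u show "inv\<^bsub>del_Pezzo_lattice n\<^esub> x \<in> dP_double n"
      unfolding dP_double_iff using dP_L_minus by blast
  next
    fix x y assume "x \<in> dP_double n" "y \<in> dP_double n"
    then obtain u w where u: "u \<in> dP_L n" "x = frag_cmul 2 u" "w \<in> dP_L n" "y = frag_cmul 2 w"
      by (auto simp: dP_double_iff)
    then have "x \<otimes>\<^bsub>del_Pezzo_lattice n\<^esub> y = frag_cmul 2 (u + w)"
      by (simp add: frag_cmul_distrib2)
    with u show "x \<otimes>\<^bsub>del_Pezzo_lattice n\<^esub> y \<in> dP_double n"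
      unfolding dP_double_iff using dP_L_add by blast
  qed
qed

lemma normal_dP_double: "dP_double n \<lhd> del_Pezzo_lattice n"
  by (rule comm_group.subgroup_imp_normal[OF comm_group_del_Pezzo subgroup_dP_double])

lemma group_dP_mod2: "group (dP_mod2 n)"
  unfolding dP_mod2_def by (rule normal.factorgroup_is_group[OF normal_dP_double])

lemma dP_coset_eq:
  "dP_double n #>\<^bsub>del_Pezzo_lattice n\<^esub> v = {v + frag_cmul 2 u |u. u \<in> dP_L n}"
  by (auto simp: r_coset_def dP_double_iff add.commute)

lemma dP_mod2_carrier:
  "X \<in> carrier (dP_mod2 n) \<longleftrightarrow>
     (\<exists>v \<in> dP_L n. X = dP_double n #>\<^bsub>del_Pezzo_lattice n\<^esub> v)"
  by (auto simp: dP_mod2_def FactGroup_def RCOSETS_def)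

lemma dP_quad_coset:
  assumes "v \<in> dP_L n"
  shows "dP_quad n (dP_double n #>\<^bsub>del_Pezzo_lattice n\<^esub> v) = of_int (dP_form n v v div 2)"
proof -
  have eq: "of_int (dP_form n (v + frag_cmul 2 u) (v + frag_cmul 2 u) div 2)
      = (of_int (dP_form n v v div 2) :: bit)" for u
  proof -
    have "dP_form n (v + frag_cmul 2 u) (v + frag_cmul 2 u)
        = dP_form n v v + 2 * (2 * (dP_form n v u + dP_form n u u))"
      by (simp add: dP_form_add_left dP_form_add_right dP_form_cmul_left dP_form_cmul_right
          dP_form_sym[of n u v])
    then have "dP_form n (v + frag_cmul 2 u) (v + frag_cmul 2 u) div 2
        = dP_form n v v div 2 + 2 * (dP_form n v u + dP_form n u u)"
      by simp
    then show ?thesis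
      by (simp only: of_int_add of_int_mult of_int_numeral bit_2_eq_0 mult_zero_left add_0_right)
  qed
  have "(\<lambda>x. of_int (dP_form n x x div 2) :: bit) ` {v + frag_cmul 2 u |u. u \<in> dP_L n}
      = {of_int (dP_form n v v div 2)}"
  proof (intro equalityI subsetI)
    fix b assume "b \<in> {of_int (dP_form n v v div 2) :: bit}"
    then have "b = of_int (dP_form n (v + frag_cmul 2 0) (v + frag_cmul 2 0) div 2)"
      by simp
    then show "b \<in> (\<lambda>x. of_int (dP_form n x x div 2)) ` {v + frag_cmul 2 u |u. u \<in> dP_L n}"
      using dP_L_zero by blast
  qed (auto simp: eq)
  then show ?thesis
    by (simp add: dP_quad_def dP_coset_eq)
qed

lemma subgroup_group_update:
  assumes "subgroup H (BijGroup S)"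
  shows "group ((BijGroup S)\<lparr>carrier := H\<rparr>)"
  using assms group_BijGroup by (rule subgroup.subgroup_is_group)

lemma dP_O_eq: "dP_O n = (BijGroup (dP_L n))\<lparr>carrier := carrier (dP_O n)\<rparr>"
  by (simp add: dP_O_def AutoGroup_def)

lemma dP_O_mod2_eq:
  "dP_O_mod2 n = (BijGroup (carrier (dP_mod2 n)))\<lparr>carrier := carrier (dP_O_mod2 n)\<rparr>"
  by (simp add: dP_O_mod2_def AutoGroup_def)

lemma dP_O_carrier:
  "f \<in> carrier (dP_O n) \<longleftrightarrow> f \<in> auto (del_Pezzo_lattice n) \<and>
     (\<forall>v \<in> dP_L n. \<forall>w \<in> dP_L n. dP_form n (f v) (f w) = dP_form n v w)"
  by (simp add: dP_O_def)

lemma dP_O_mod2_carrier: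
  "g \<in> carrier (dP_O_mod2 n) \<longleftrightarrow> g \<in> auto (dP_mod2 n) \<and> (\<forall>X \<in> carrier (dP_mod2 n).
     (\<forall>c. g (dP_mod2_scale n c X) = dP_mod2_scale n c (g X)) \<and> dP_quad n (g X) = dP_quad n X)"
  by (simp add: dP_O_mod2_def)

lemma auto_Bij: "f \<in> auto G \<Longrightarrow> f \<in> Bij (carrier G)"
  by (simp add: auto_def)

lemma auto_mem: "f \<in> auto G \<Longrightarrow> v \<in> carrier G \<Longrightarrow> f v \<in> carrier G"
  by (auto simp: auto_def hom_def)

lemma Bij_inv_into_f: "f \<in> Bij S \<Longrightarrow> v \<in> S \<Longrightarrow> f (inv_into S f v) = v"
  by (auto simp: Bij_def bij_betw_def intro: f_inv_into_f)

lemma group_dP_O: "group (dP_O n)"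
proof -
  interpret L: comm_group "del_Pezzo_lattice n" by (rule comm_group_del_Pezzo)
  interpret A: subgroup "auto (del_Pezzo_lattice n)" "BijGroup (dP_L n)"
    by (rule L.subgroup_auto)
  interpret B: group "BijGroup (dP_L n)" by (rule group_BijGroup)
  have "subgroup (carrier (dP_O n)) (BijGroup (dP_L n))"
  proof (rule B.subgroupI)
    show "carrier (dP_O n) \<subseteq> carrier (BijGroup (dP_L n))"
      using A.subset by (auto simp: dP_O_carrier)
    show "carrier (dP_O n) \<noteq> {}"
      using A.one_closed
      by (intro ex_in_conv[THEN iffD1] exI[of _ "\<lambda>v \<in> dP_L n. v"])
         (simp add: dP_O_carrier BijGroup_def)
  next
    fix f assume f: "f \<in> carrier (dP_O n)"
    then have fB: "f \<in> Bij (dP_L n)"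
      by (simp add: dP_O_carrier auto_Bij)
    have eq: "(inv\<^bsub>BijGroup (dP_L n)\<^esub> f) v = inv_into (dP_L n) f v" if "v \<in> dP_L n" for v
      using that by (simp add: inv_BijGroup[OF fB])
    have "dP_form n (inv_into (dP_L n) f v) (inv_into (dP_L n) f w) = dP_form n v w"
      if "v \<in> dP_L n" "w \<in> dP_L n" for v w
    proof -
      have "dP_form n (f (inv_into (dP_L n) f v)) (f (inv_into (dP_L n) f w))
          = dP_form n (inv_into (dP_L n) f v) (inv_into (dP_L n) f w)"
        using f that fB by (auto simp: dP_O_carrier Bij_inv_into_mem)
      then show ?thesis
        using that fB by (simp add: Bij_inv_into_f)
    qed
    then show "inv\<^bsub>BijGroup (dP_L n)\<^esub> f \<in> carrier (dP_O n)"
      using f A.m_inv_closed by (auto simp: dP_O_carrier eq)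
  next
    fix f g assume fg: "f \<in> carrier (dP_O n)" "g \<in> carrier (dP_O n)"
    then have B: "f \<in> Bij (dP_L n)" "g \<in> Bij (dP_L n)"
      by (simp_all add: dP_O_carrier auto_Bij)
    then have eq: "(f \<otimes>\<^bsub>BijGroup (dP_L n)\<^esub> g) v = f (g v)" if "v \<in> dP_L n" for v
      using that by (simp add: BijGroup_def compose_def)
    show "f \<otimes>\<^bsub>BijGroup (dP_L n)\<^esub> g \<in> carrier (dP_O n)"
      using fg A.m_closed auto_mem[of g "del_Pezzo_lattice n"]
      by (auto simp: dP_O_carrier eq)
  qed
  then show ?thesis
    by (subst dP_O_eq) (rule subgroup_group_update)
qed

lemma dP_mod2_scale_closed:
  "X \<in> carrier (dP_mod2 n) \<Longrightarrow> dP_mod2_scale n c X \<in> carrier (dP_mod2 n)"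
  using group.is_monoid[OF group_dP_mod2, of n]
  by (simp add: dP_mod2_scale_def monoid.one_closed)

lemma auto_dP_mod2_scale:
  assumes "g \<in> auto (dP_mod2 n)"
  shows "g (dP_mod2_scale n c X) = dP_mod2_scale n c (g X)"
  using assms group_dP_mod2[of n] hom_one[of g "dP_mod2 n" "dP_mod2 n"]
  by (simp add: dP_mod2_scale_def auto_def)

lemma group_dP_O_mod2: "group (dP_O_mod2 n)"
proof -
  interpret L: group "dP_mod2 n" by (rule group_dP_mod2)
  let ?S = "carrier (dP_mod2 n)"
  interpret A: subgroup "auto (dP_mod2 n)" "BijGroup ?S"
    by (rule L.subgroup_auto)
  interpret B: group "BijGroup ?S" by (rule group_BijGroup)
  have "subgroup (carrier (dP_O_mod2 n)) (BijGroup ?S)"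
  proof (rule B.subgroupI)
    show "carrier (dP_O_mod2 n) \<subseteq> carrier (BijGroup ?S)"
      using A.subset by (auto simp: dP_O_mod2_carrier)
    show "carrier (dP_O_mod2 n) \<noteq> {}"
      using A.one_closed auto_dP_mod2_scale[OF A.one_closed]
      by (intro ex_in_conv[THEN iffD1] exI[of _ "\<lambda>v \<in> ?S. v"])
         (simp add: dP_O_mod2_carrier BijGroup_def)
  next
    fix f assume f: "f \<in> carrier (dP_O_mod2 n)"
    then have fB: "f \<in> Bij ?S" and fa: "f \<in> auto (dP_mod2 n)"
      by (simp_all add: dP_O_mod2_carrier auto_Bij)
    have eq: "(inv\<^bsub>BijGroup ?S\<^esub> f) v = inv_into ?S f v" if "v \<in> ?S" for v
      using that by (simp add: inv_BijGroup[OF fB])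
    have "dP_quad n (inv_into ?S f v) = dP_quad n v" if "v \<in> ?S" for v
    proof -
      have "dP_quad n (f (inv_into ?S f v)) = dP_quad n (inv_into ?S f v)"
        using f that fB by (auto simp: dP_O_mod2_carrier Bij_inv_into_mem)
      then show ?thesis
        using that fB by (simp add: Bij_inv_into_f)
    qed
    then show "inv\<^bsub>BijGroup ?S\<^esub> f \<in> carrier (dP_O_mod2 n)"
      using A.m_inv_closed[OF fa] auto_dP_mod2_scale[OF A.m_inv_closed[OF fa]]
      by (simp add: dP_O_mod2_carrier eq)
  next
    fix f g assume fg: "f \<in> carrier (dP_O_mod2 n)" "g \<in> carrier (dP_O_mod2 n)"
    then have B: "f \<in> Bij ?S" "g \<in> Bij ?S"
        and a: "f \<in> auto (dP_mod2 n)" "g \<in> auto (dP_mod2 n)"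
      by (simp_all add: dP_O_mod2_carrier auto_Bij)
    then have eq: "(f \<otimes>\<^bsub>BijGroup ?S\<^esub> g) v = f (g v)" if "v \<in> ?S" for v
      using that by (simp add: BijGroup_def compose_def)
    show "f \<otimes>\<^bsub>BijGroup ?S\<^esub> g \<in> carrier (dP_O_mod2 n)"
      using fg A.m_closed[OF a] auto_dP_mod2_scale[OF A.m_closed[OF a]] auto_mem[OF a(2)]
      by (simp add: dP_O_mod2_carrier eq)
  qed
  then show ?thesis
    by (subst dP_O_mod2_eq) (rule subgroup_group_update)
qed

lemma auto_dP_add:
  "f \<in> auto (del_Pezzo_lattice n) \<Longrightarrow> v \<in> dP_L n \<Longrightarrow> w \<in> dP_L n \<Longrightarrow> f (v + w) = f v + f w"
  by (auto simp: auto_def hom_def)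

lemma auto_surj: "f \<in> auto G \<Longrightarrow> f ` carrier G = carrier G"
  by (auto simp: auto_def Bij_def bij_betw_def)

lemma image_dP_coset:
  assumes f: "f \<in> auto (del_Pezzo_lattice n)" and v: "v \<in> dP_L n"
  shows "f ` (dP_double n #>\<^bsub>del_Pezzo_lattice n\<^esub> v)
       = dP_double n #>\<^bsub>del_Pezzo_lattice n\<^esub> f v"
proof -
  have eq: "f (v + frag_cmul 2 u) = f v + frag_cmul 2 (f u)" if "u \<in> dP_L n" for u
  proof -
    have "frag_cmul 2 w = w + w" for w :: "nat \<Rightarrow>\<^sub>0 int"
      using frag_cmul_distrib[of 1 1 w] by simp
    then show ?thesis
      using that v f by (simp only: auto_dP_add dP_L_add)
  qed
  show ?thesis
    unfolding dP_coset_eq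
  proof (intro equalityI subsetI)
    fix x assume "x \<in> f ` {v + frag_cmul 2 u |u. u \<in> dP_L n}"
    then show "x \<in> {f v + frag_cmul 2 u |u. u \<in> dP_L n}"
      using eq auto_mem[OF f] by auto
  next
    fix x assume "x \<in> {f v + frag_cmul 2 u |u. u \<in> dP_L n}"
    then obtain u where "u \<in> dP_L n" "x = f v + frag_cmul 2 u" by auto
    moreover obtain u' where "u' \<in> dP_L n" "u = f u'"
      using auto_surj[OF f] \<open>u \<in> dP_L n\<close> by blast
    ultimately show "x \<in> f ` {v + frag_cmul 2 u |u. u \<in> dP_L n}"
      using eq[of u'] by (auto simp: image_iff)
  qed
qed

lemma dP_rho_coset:
  assumes "f \<in> auto (del_Pezzo_lattice n)" "v \<in> dP_L n"
  shows "dP_rho n f (dP_double n #>\<^bsub>del_Pezzo_lattice n\<^esub> v)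
       = dP_double n #>\<^bsub>del_Pezzo_lattice n\<^esub> f v"
proof -
  have "dP_double n #>\<^bsub>del_Pezzo_lattice n\<^esub> v \<in> carrier (dP_mod2 n)"
    using assms by (auto simp: dP_mod2_carrier)
  then show ?thesis
    by (simp add: dP_rho_def image_dP_coset[OF assms])
qed

lemma dP_mult_coset:
  assumes "v \<in> dP_L n" "w \<in> dP_L n"
  shows "(dP_double n #>\<^bsub>del_Pezzo_lattice n\<^esub> v) \<otimes>\<^bsub>dP_mod2 n\<^esub> (dP_double n #>\<^bsub>del_Pezzo_lattice n\<^esub> w)
       = dP_double n #>\<^bsub>del_Pezzo_lattice n\<^esub> (v + w)"
  using normal.rcos_sum[OF normal_dP_double assms] by (simp add: dP_mod2_def)

lemma dP_rho_closed:
  assumes f: "f \<in> carrier (dP_O n)"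
  shows "dP_rho n f \<in> carrier (dP_O_mod2 n)"
proof -
  let ?S = "carrier (dP_mod2 n)"
  have fa: "f \<in> auto (del_Pezzo_lattice n)" using f by (simp add: dP_O_carrier)
  have inj: "inj_on f (dP_L n)"
    using fa by (auto simp: auto_def Bij_def bij_betw_def)
  have sub: "X \<subseteq> dP_L n" if "X \<in> ?S" for X
    using that by (auto simp: dP_mod2_carrier dP_coset_eq dP_L_add dP_L_cmul)
  have closed: "dP_rho n f X \<in> ?S" if "X \<in> ?S" for X
    using that fa auto_mem[OF fa] by (auto simp: dP_mod2_carrier dP_rho_coset)
  have "dP_rho n f \<in> hom (dP_mod2 n) (dP_mod2 n)"
  proof (rule homI)
    fix X Y assume "X \<in> ?S" "Y \<in> ?S"
    then obtain v w where vw: "v \<in> dP_L n" "w \<in> dP_L n"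
        "X = dP_double n #>\<^bsub>del_Pezzo_lattice n\<^esub> v" "Y = dP_double n #>\<^bsub>del_Pezzo_lattice n\<^esub> w"
      by (auto simp: dP_mod2_carrier)
    show "dP_rho n f (X \<otimes>\<^bsub>dP_mod2 n\<^esub> Y) = dP_rho n f X \<otimes>\<^bsub>dP_mod2 n\<^esub> dP_rho n f Y"
      unfolding vw(3,4) dP_mult_coset[OF vw(1,2)] dP_rho_coset[OF fa vw(1)]
        dP_rho_coset[OF fa vw(2)] dP_rho_coset[OF fa dP_L_add[OF vw(1,2)]]
        auto_dP_add[OF fa vw(1,2)]
      by (rule dP_mult_coset[OF auto_mem[OF fa vw(1)] auto_mem[OF fa vw(2)], symmetric])
  qed (rule closed)
  moreover have "bij_betw (dP_rho n f) ?S ?S"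
  proof (rule bij_betw_imageI)
    show "inj_on (dP_rho n f) ?S"
    proof (rule inj_onI)
      fix X Y assume S: "X \<in> ?S" "Y \<in> ?S" and "dP_rho n f X = dP_rho n f Y"
      then have "f ` X = f ` Y" by (simp add: dP_rho_def)
      then show "X = Y"
        using inj_on_image_eq_iff[OF inj sub[OF S(1)] sub[OF S(2)]] by blast
    qed
    show "dP_rho n f ` ?S = ?S"
    proof
      show "?S \<subseteq> dP_rho n f ` ?S"
      proof
        fix X assume "X \<in> ?S"
        then obtain v where v: "v \<in> dP_L n" "X = dP_double n #>\<^bsub>del_Pezzo_lattice n\<^esub> v"
          by (auto simp: dP_mod2_carrier)
        then obtain w where w: "w \<in> dP_L n" "v = f w"
          using auto_surj[OF fa] by blast
        then have "X = dP_rho n f (dP_double n #>\<^bsub>del_Pezzo_lattice n\<^esub> w)"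
          using v fa by (simp add: dP_rho_coset)
        then show "X \<in> dP_rho n f ` ?S"
          using w(1) by (metis dP_mod2_carrier imageI)
      qed
    qed (use closed in auto)
  qed
  moreover have "dP_rho n f \<in> extensional ?S"
    by (simp add: dP_rho_def)
  ultimately have a: "dP_rho n f \<in> auto (dP_mod2 n)"
    by (simp add: auto_def Bij_def)
  have "dP_quad n (dP_rho n f X) = dP_quad n X" if "X \<in> ?S" for X
    using that f fa auto_mem[OF fa]
    by (auto simp: dP_mod2_carrier dP_rho_coset dP_quad_coset dP_O_carrier)
  with a show ?thesis
    by (simp add: dP_O_mod2_carrier auto_dP_mod2_scale)
qed

lemma dP_O_mult:
  assumes "f \<in> carrier (dP_O n)" "g \<in> carrier (dP_O n)"
  shows "f \<otimes>\<^bsub>dP_O n\<^esub> g = compose (dP_L n) f g"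
  using assms by (simp add: dP_O_def AutoGroup_def BijGroup_def auto_def)

lemma dP_O_mod2_mult:
  assumes "f \<in> carrier (dP_O_mod2 n)" "g \<in> carrier (dP_O_mod2 n)"
  shows "f \<otimes>\<^bsub>dP_O_mod2 n\<^esub> g = compose (carrier (dP_mod2 n)) f g"
  using assms by (simp add: dP_O_mod2_def AutoGroup_def BijGroup_def auto_def)

lemma dP_rho_hom: "dP_rho n \<in> hom (dP_O n) (dP_O_mod2 n)"
proof (rule homI)
  fix f g assume fg: "f \<in> carrier (dP_O n)" "g \<in> carrier (dP_O n)"
  then have a: "f \<in> auto (del_Pezzo_lattice n)" "g \<in> auto (del_Pezzo_lattice n)"
    by (simp_all add: dP_O_carrier)
  have m: "f \<otimes>\<^bsub>dP_O n\<^esub> g \<in> auto (del_Pezzo_lattice n)"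
    using monoid.m_closed[OF group.is_monoid[OF group_dP_O] fg] by (simp add: dP_O_carrier)
  show "dP_rho n (f \<otimes>\<^bsub>dP_O n\<^esub> g) = dP_rho n f \<otimes>\<^bsub>dP_O_mod2 n\<^esub> dP_rho n g"
    unfolding dP_O_mod2_mult[OF dP_rho_closed dP_rho_closed, OF fg]
  proof (rule extensionalityI)
    fix X assume X: "X \<in> carrier (dP_mod2 n)"
    then obtain v where v: "v \<in> dP_L n" "X = dP_double n #>\<^bsub>del_Pezzo_lattice n\<^esub> v"
      by (auto simp: dP_mod2_carrier)
    have "(f \<otimes>\<^bsub>dP_O n\<^esub> g) v = f (g v)"
      using v by (simp add: dP_O_mult[OF fg] compose_eq)
    then show "dP_rho n (f \<otimes>\<^bsub>dP_O n\<^esub> g) X = compose (carrier (dP_mod2 n)) (dP_rho n f) (dP_rho n g) X"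
      unfolding compose_eq[OF X] using v a m auto_mem[OF a(2)] by (simp add: dP_rho_coset)
  qed (auto simp: dP_rho_def compose_def)
qed (rule dP_rho_closed)

lemma dP_O_one: "\<one>\<^bsub>dP_O n\<^esub> = (\<lambda>v \<in> dP_L n. v)"
  by (simp add: dP_O_def AutoGroup_def BijGroup_def)

lemma dP_O_minus: "(\<lambda>v \<in> dP_L n. - v) \<in> carrier (dP_O n)"
proof -
  have "bij_betw (\<lambda>v \<in> dP_L n. - v) (dP_L n) (dP_L n)"
    by (rule bij_betw_byWitness[where f' = "\<lambda>v. - v"]) (auto simp: dP_L_minus)
  then show ?thesis
    by (auto simp: dP_O_carrier auto_def Bij_def hom_def dP_L_minus dP_L_add
        dP_form_minus_left dP_form_minus_right)
qed

lemma auto_dP_minus: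
  assumes "f \<in> auto (del_Pezzo_lattice n)" "v \<in> dP_L n"
  shows "f (- v) = - f v"
proof -
  have "f 0 = 0"
    using auto_dP_add[OF assms(1) dP_L_zero dP_L_zero] by simp
  then show ?thesis
    using auto_dP_add[OF assms dP_L_minus[OF assms(2)]] by (simp add: eq_neg_iff_add_eq_0 add.commute)
qed

lemma normal_dP_pm1: "dP_pm1 n \<lhd> dP_O n"
proof -
  let ?m = "\<lambda>v \<in> dP_L n. - v"
  interpret group "dP_O n" by (rule group_dP_O)
  have m: "?m \<in> carrier (dP_O n)" by (rule dP_O_minus)
  have mm: "?m \<otimes>\<^bsub>dP_O n\<^esub> ?m = \<one>\<^bsub>dP_O n\<^esub>"
    unfolding dP_O_mult[OF m m] dP_O_one by (auto simp: compose_def fun_eq_iff dP_L_minus)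
  then have inv_m: "inv\<^bsub>dP_O n\<^esub> ?m = ?m"
    using m by (intro inv_equality)
  have comm: "f \<otimes>\<^bsub>dP_O n\<^esub> ?m = ?m \<otimes>\<^bsub>dP_O n\<^esub> f" if f: "f \<in> carrier (dP_O n)" for f
  proof -
    have a: "f \<in> auto (del_Pezzo_lattice n)" using f by (simp add: dP_O_carrier)
    show ?thesis
      unfolding dP_O_mult[OF f m] dP_O_mult[OF m f]
      using auto_mem[OF a] auto_dP_minus[OF a] by (auto simp: compose_def fun_eq_iff)
  qed
  show ?thesis
  proof (rule normal_invI)
    show "subgroup (dP_pm1 n) (dP_O n)"
      by (rule subgroupI) (use m mm inv_m in \<open>auto simp: dP_pm1_def simp del: restrict_apply\<close>)
    fix f h assume f: "f \<in> carrier (dP_O n)" and h: "h \<in> dP_pm1 n"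
    have hc: "h \<in> carrier (dP_O n)" using h m by (auto simp: dP_pm1_def)
    have "f \<otimes>\<^bsub>dP_O n\<^esub> h = h \<otimes>\<^bsub>dP_O n\<^esub> f"
      using h f comm by (auto simp: dP_pm1_def)
    then have "f \<otimes>\<^bsub>dP_O n\<^esub> h \<otimes>\<^bsub>dP_O n\<^esub> inv\<^bsub>dP_O n\<^esub> f = h"
      using f hc by (simp add: m_assoc)
    with h show "f \<otimes>\<^bsub>dP_O n\<^esub> h \<otimes>\<^bsub>dP_O n\<^esub> inv\<^bsub>dP_O n\<^esub> f \<in> dP_pm1 n" by simp
  qed
qed

end

theory Submission
  imports Defs
begin

text \<open>Write \<open>q\<close> for the reduced quadratic form. A class of \<open>L/2L\<close> is determined by the set \<open>S\<close> of odd
  coordinates among \<open>1, \<dots>, n\<close>, and \<open>q\<close> is \<open>1\<close> on it iff \<open>card S\<close> is \<open>2\<close> or \<open>3\<close> modulo \<open>4\<close>. Hence every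
  class outside the radical with \<open>q = 1\<close> contains a root, and by positivity that root is unique up to
  sign. Given an isometry \<open>g\<close> of \<open>L/2L\<close>, lift the images of the simple roots to roots; their scalar
  products agree with those of the simple roots up to sign, and since the Dynkin diagram is a tree the
  signs of the lifts can be adjusted to make them equal. The resulting linear map is an isometry of
  \<open>L\<close>, surjective because there are finitely many vectors of each norm. Conversely, an isometry trivial
  modulo \<open>2\<close> maps each simple root to plus or minus itself, with the same sign throughout because the
  diagram is connected.\<close>

text \<open>The simplifier would turn \<open>frag_of 0\<close> into the unit \<open>1\<close> of the convolution product on \<open>\<Rightarrow>\<^sub>0\<close>.\<close>

declare single_one [simp del]

abbreviation dP_coset :: "nat \<Rightarrow> (nat \<Rightarrow>\<^sub>0 int) \<Rightarrow> (nat \<Rightarrow>\<^sub>0 int) set" where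
  "dP_coset n v \<equiv> dP_double n #>\<^bsub>del_Pezzo_lattice n\<^esub> v"

section \<open>Bilinearity, coordinates and positive definiteness of the form\<close>

lemma dP_form_diff_left: "dP_form n (u - v) w = dP_form n u w - dP_form n v w"
  using dP_form_add_left[of n u "- v" w] by (simp add: dP_form_minus_left)

lemma dP_form_diff_right: "dP_form n w (u - v) = dP_form n w u - dP_form n w v"
  using dP_form_add_right[of n w u "- v"] by (simp add: dP_form_minus_right)

lemma dP_form_sum_left: "dP_form n (sum u A) w = (\<Sum>i\<in>A. dP_form n (u i) w)"
  by (induction A rule: infinite_finite_induct) (auto simp: dP_form_zero_left dP_form_add_left)

lemma dP_form_sum_right: "dP_form n w (sum u A) = (\<Sum>i\<in>A. dP_form n w (u i))"
  by (metis (no_types, lifting) dP_form_sum_left dP_form_sym sum.cong)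

lemma dP_L_diff: "v \<in> dP_L n \<Longrightarrow> w \<in> dP_L n \<Longrightarrow> v - w \<in> dP_L n"
  using dP_L_add[of v n "- w"] dP_L_minus by auto

lemma frag_cmul_two: "frag_cmul 2 v = v + v"
  using frag_cmul_distrib[of 1 1 v] by simp

lemma dP_L_alt:
  "v \<in> dP_L n \<longleftrightarrow> Poly_Mapping.keys v \<subseteq> {0..n} \<and>
     (\<Sum>i=1..n. Poly_Mapping.lookup v i) = - 3 * Poly_Mapping.lookup v 0"
proof -
  have "dP_form n v (dP_K n) = - 3 * Poly_Mapping.lookup v 0 - (\<Sum>i=1..n. Poly_Mapping.lookup v i)"
    by (simp add: dP_form_def lookup_dP_K sum_negf)
  then show ?thesis
    by (auto simp: dP_L_iff)
qed

lemma dP_L_lookup_eq_0: "v \<in> dP_L n \<Longrightarrow> n < i \<Longrightarrow> Poly_Mapping.lookup v i = 0"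
  by (meson atLeastAtMost_iff dP_L_alt in_keys_iff linorder_not_le subsetD)

text \<open>Completing squares, with \<open>\<Sum>i=1..n. x\<^sub>i = -3x\<^sub>0\<close>, exhibits the form as positive definite for \<open>n \<le> 8\<close>.\<close>

lemma nine_dP_form:
  assumes "v \<in> dP_L n"
  shows "9 * dP_form n v v =
    (\<Sum>i=1..n. (3 * Poly_Mapping.lookup v i + Poly_Mapping.lookup v 0)\<^sup>2)
      + (9 - int n) * (Poly_Mapping.lookup v 0)\<^sup>2"
proof -
  let ?x = "Poly_Mapping.lookup v"
  have S: "(\<Sum>i=1..n. ?x i) = - 3 * ?x 0"
    using assms by (simp add: dP_L_alt)
  have "(\<Sum>i=1..n. (3 * ?x i + ?x 0)\<^sup>2) =
      (\<Sum>i=1..n. 9 * (?x i * ?x i) + 6 * ?x 0 * ?x i + (?x 0)\<^sup>2)"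
    by (rule sum.cong) (auto simp: power2_eq_square algebra_simps)
  also have "\<dots> = 9 * (\<Sum>i=1..n. ?x i * ?x i) + 6 * ?x 0 * (\<Sum>i=1..n. ?x i) + int n * (?x 0)\<^sup>2"
    by (simp add: sum.distrib sum_distrib_left)
  finally show ?thesis
    unfolding S dP_form_def by (simp add: power2_eq_square algebra_simps)
qed

text \<open>All summands in \<open>nine_dP_form\<close> are nonnegative, and
  \<open>n \<le> 8\<close> makes the factor \<open>9 - int n\<close> at least 1, so each single
  square is bounded by the total.\<close>

lemma dP_lookup_bounds:
  assumes v: "v \<in> dP_L n" and "n \<le> 8"
  shows "(Poly_Mapping.lookup v 0)\<^sup>2 \<le> 9 * dP_form n v v"
    and "i \<in> {1..n} \<Longrightarrow> (3 * Poly_Mapping.lookup v i + Poly_Mapping.lookup v 0)\<^sup>2 \<le> 9 * dP_form n v v"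
proof -
  let ?x = "Poly_Mapping.lookup v"
  let ?S = "\<Sum>i=1..n. (3 * ?x i + ?x 0)\<^sup>2"
  have S: "0 \<le> ?S" by (intro sum_nonneg) auto
  have x: "(?x 0)\<^sup>2 \<le> (9 - int n) * (?x 0)\<^sup>2"
    using mult_right_mono[of 1 "9 - int n" "(?x 0)\<^sup>2"] assms(2) by simp
  show "(?x 0)\<^sup>2 \<le> 9 * dP_form n v v"
    using S x nine_dP_form[OF v] by linarith
  assume "i \<in> {1..n}"
  then have "(3 * ?x i + ?x 0)\<^sup>2 \<le> ?S"
    by (intro member_le_sum) auto
  then show "(3 * ?x i + ?x 0)\<^sup>2 \<le> 9 * dP_form n v v"
    using x nine_dP_form[OF v] zero_le_power2[of "?x 0"] by linarith
qed

lemma dP_form_nonneg: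
  assumes "v \<in> dP_L n" "n \<le> 8"
  shows "0 \<le> dP_form n v v"
  using dP_lookup_bounds(1)[OF assms] zero_le_power2[of "Poly_Mapping.lookup v 0"] by linarith

lemma dP_form_eq_0_imp:
  assumes "v \<in> dP_L n" "n \<le> 8" "dP_form n v v = 0"
  shows "v = 0"
proof (rule poly_mapping_eqI)
  fix i
  have 0: "Poly_Mapping.lookup v 0 = 0"
    using dP_lookup_bounds(1)[OF assms(1,2)] assms(3) by simp
  consider "i = 0" | "i \<in> {1..n}" | "n < i" by force
  then show "Poly_Mapping.lookup v i = Poly_Mapping.lookup 0 i"
    using 0 dP_lookup_bounds(2)[OF assms(1,2), of i] assms(3) dP_L_lookup_eq_0[OF assms(1), of i]
    by cases auto
qed

text \<open>The norm bounds every coordinate. This finiteness later turns injectivity of an isometry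
  into surjectivity.\<close>

lemma finite_dP_form_eq:
  assumes "n \<le> 8"
  shows "finite {v \<in> dP_L n. dP_form n v v = N}"
proof -
  \<comment> \<open>Since \<open>x 0\<close> and \<open>3 * x i + x 0\<close> are at most
    \<open>9 * N\<close> in absolute value, \<open>3 * x i\<close> is at most \<open>18 * N\<close>,
    a crude but sufficient bound for \<open>x i\<close>. The value 0 outside \<open>{0..n}\<close>
    makes this set of functions finite.\<close>
  let ?F = "{x. \<forall>i. (i \<in> {0..n} \<longrightarrow> x i \<in> {- (18 * N)..18 * N}) \<and> (i \<notin> {0..n} \<longrightarrow> x i = 0)}"
  have abs_le_square: "\<bar>a\<bar> \<le> a\<^sup>2" for a :: int
    using self_le_power[of "\<bar>a\<bar>" 2] by (cases "a = 0") auto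
  have "Poly_Mapping.lookup v \<in> ?F" if v: "v \<in> dP_L n" and N: "dP_form n v v = N" for v
  proof -
    have "\<bar>Poly_Mapping.lookup v 0\<bar> \<le> 9 * N"
      using dP_lookup_bounds(1)[OF v assms] abs_le_square[of "Poly_Mapping.lookup v 0"] N by linarith
    moreover have "\<bar>3 * Poly_Mapping.lookup v i + Poly_Mapping.lookup v 0\<bar> \<le> 9 * N" if "i \<in> {1..n}" for i
      using dP_lookup_bounds(2)[OF v assms that] N
        abs_le_square[of "3 * Poly_Mapping.lookup v i + Poly_Mapping.lookup v 0"] by linarith
    ultimately have "\<bar>Poly_Mapping.lookup v i\<bar> \<le> 18 * N" if "i \<in> {0..n}" for i
      using that by (cases "i = 0") (force, smt (verit) One_nat_def Suc_leI atLeastAtMost_iff not_gr_zero)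
    then show ?thesis
      using dP_L_lookup_eq_0[OF v] by (force simp: abs_le_iff)
  qed
  moreover have "finite ?F"
    by (rule finite_set_of_finite_funs) auto
  moreover have "inj_on Poly_Mapping.lookup {v \<in> dP_L n. dP_form n v v = N}"
    by (simp add: inj_on_def)
  ultimately show ?thesis
    by (intro inj_on_finite[of Poly_Mapping.lookup _ ?F]) auto
qed

section \<open>Classes modulo 2 as parity patterns\<close>

lemma dP_coset_eq_iff:
  assumes "v \<in> dP_L n" "w \<in> dP_L n"
  shows "dP_coset n v = dP_coset n w \<longleftrightarrow> (\<exists>u \<in> dP_L n. v = w + frag_cmul 2 u)"
proof
  assume eq: "dP_coset n v = dP_coset n w"
  have "v + frag_cmul 2 0 \<in> dP_coset n v"
    using dP_L_zero unfolding dP_coset_eq by blast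
  then show "\<exists>u \<in> dP_L n. v = w + frag_cmul 2 u"
    unfolding eq unfolding dP_coset_eq by auto
next
  assume "\<exists>u \<in> dP_L n. v = w + frag_cmul 2 u"
  then obtain u where u: "u \<in> dP_L n" "v = w + frag_cmul 2 u" by blast
  have "\<exists>y \<in> dP_L n. v + frag_cmul 2 x = w + frag_cmul 2 y" if "x \<in> dP_L n" for x
    using u that by (intro bexI[of _ "u + x"]) (auto simp: frag_cmul_distrib2 dP_L_add)
  moreover have "\<exists>y \<in> dP_L n. w + frag_cmul 2 x = v + frag_cmul 2 y" if "x \<in> dP_L n" for x
    using u that by (intro bexI[of _ "x - u"]) (auto simp: frag_cmul_two dP_L_diff)
  ultimately show "dP_coset n v = dP_coset n w"
    unfolding dP_coset_eq by blast
qed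

text \<open>Orthogonality to \<open>dP_K n\<close> gives coordinate 0 the parity of the sum of the
  others. So if the coordinates \<open>1..n\<close> of a difference are even, all are, and the
  difference can be halved.\<close>

lemma dP_coset_eq_iff_parity:
  assumes v: "v \<in> dP_L n" and w: "w \<in> dP_L n"
  shows "dP_coset n v = dP_coset n w \<longleftrightarrow>
    (\<forall>i \<in> {1..n}. even (Poly_Mapping.lookup v i) \<longleftrightarrow> even (Poly_Mapping.lookup w i))"
proof
  assume "dP_coset n v = dP_coset n w"
  then obtain u where "v = w + frag_cmul 2 u"
    using dP_coset_eq_iff[OF v w] by blast
  then show "\<forall>i \<in> {1..n}. even (Poly_Mapping.lookup v i) \<longleftrightarrow> even (Poly_Mapping.lookup w i)"
    by (simp add: lookup_add)
next
  assume par: "\<forall>i \<in> {1..n}. even (Poly_Mapping.lookup v i) \<longleftrightarrow> even (Poly_Mapping.lookup w i)"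
  define d where "d = v - w"
  have d: "d \<in> dP_L n" using v w by (simp add: d_def dP_L_diff)
  have ev: "even (Poly_Mapping.lookup d i)" if "i \<in> {1..n}" for i
    using par that by (simp add: d_def lookup_minus)
  have "even (\<Sum>i=1..n. Poly_Mapping.lookup d i)"
    using ev by (rule dvd_sum)
  then have "even (Poly_Mapping.lookup d 0)"
    using d by (simp add: dP_L_alt)
  with ev have ev': "even (Poly_Mapping.lookup d i)" for i
    using dP_L_lookup_eq_0[OF d, of i] by (cases "i = 0"; cases "n < i") auto
  define u where "u = Poly_Mapping.map (\<lambda>a. a div 2) d"
  have "d = frag_cmul 2 u"
    by (rule poly_mapping_eqI) (use ev' in \<open>simp add: u_def map.rep_eq when_def\<close>)
  moreover have "u \<in> dP_L n"
  proof -
    have "Poly_Mapping.keys u = Poly_Mapping.keys d"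
      using ev' by (auto simp: u_def in_keys_iff map.rep_eq when_def dvd_div_eq_0_iff)
    \<comment> \<open>The lattice is primitive in the ambient one: orthogonality of
      \<open>2u\<close> to \<open>dP_K n\<close> forces that of \<open>u\<close>.\<close>
    moreover have "2 * dP_form n u (dP_K n) = 0"
      using d \<open>d = frag_cmul 2 u\<close> by (metis dP_L_iff dP_form_cmul_left)
    ultimately show ?thesis
      using d by (simp add: dP_L_iff)
  qed
  ultimately show "dP_coset n v = dP_coset n w"
    unfolding dP_coset_eq_iff[OF v w] d_def by (metis add.commute diff_add_cancel)
qed

lemma dP_coset_minus: "v \<in> dP_L n \<Longrightarrow> dP_coset n (- v) = dP_coset n v"
  by (simp add: dP_coset_eq_iff_parity dP_L_minus)

section \<open>Roots in the classes with q = 1, and their uniqueness up to sign\<close>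

text \<open>Here \<open>a\<close> becomes coordinate 0, \<open>sum\<close> expresses orthogonality
  to \<open>dP_K n\<close>, and \<open>sq\<close> expresses norm 2. Finding a root in a class is
  thus a choice of integers with prescribed parities.\<close>

lemma exists_dP_root_if_coords:
  fixes x :: "nat \<Rightarrow> int"
  assumes v: "v \<in> dP_L n" and sum: "(\<Sum>i=1..n. x i) = - 3 * a"
    and sq: "(\<Sum>i=1..n. x i * x i) = a * a + 2"
    and par: "\<And>i. i \<in> {1..n} \<Longrightarrow> even (x i) \<longleftrightarrow> even (Poly_Mapping.lookup v i)"
  shows "\<exists>r \<in> dP_L n. dP_form n r r = 2 \<and> dP_coset n r = dP_coset n v"
proof -
  define y where "y i = (if i = 0 then a else if i \<le> n then x i else 0)" for i
  have "finite {i. y i \<noteq> 0}"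
    by (rule finite_subset[of _ "{0..n}"]) (auto simp: y_def)
  then have lk: "Poly_Mapping.lookup (Abs_poly_mapping y) = y"
    by (rule lookup_Abs_poly_mapping)
  have "(\<Sum>i=1..n. y i) = (\<Sum>i=1..n. x i)" "(\<Sum>i=1..n. y i * y i) = (\<Sum>i=1..n. x i * x i)"
    by (auto simp: y_def intro!: sum.cong)
  then have "Abs_poly_mapping y \<in> dP_L n" "dP_form n (Abs_poly_mapping y) (Abs_poly_mapping y) = 2"
    using sum sq by (auto simp: dP_L_alt dP_form_def lk in_keys_iff y_def split: if_splits)
  moreover from this(1) have "dP_coset n (Abs_poly_mapping y) = dP_coset n v"
    using v par by (auto simp: dP_coset_eq_iff_parity lk y_def)
  ultimately show ?thesis by blast
qed

text \<open>A square is 1 or 0 modulo 4 according to parity, and coordinate 0 has the parity of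
  \<open>k\<close>. Hence the norm is \<open>k\<close> modulo 4 for even \<open>k\<close> and
  \<open>k - 1\<close> for odd \<open>k\<close>.\<close>

lemma odd_dP_form_half_iff:
  assumes v: "v \<in> dP_L n"
  defines "k \<equiv> card {i \<in> {1..n}. odd (Poly_Mapping.lookup v i)}"
  shows "odd (dP_form n v v div 2) \<longleftrightarrow> k mod 4 \<in> {2, 3}"
proof -
  let ?x = "Poly_Mapping.lookup v"
  have sq: "4 dvd a * a - of_bool (odd a)" for a :: int
  proof (cases "even a")
    case False
    then obtain m where "a = 2 * m + 1" by (elim oddE)
    then have "a * a - of_bool (odd a) = 4 * (m * m + m)" by (simp add: algebra_simps)
    then show ?thesis by (metis dvd_triv_left)
  qed (auto elim!: evenE)
  have k: "(\<Sum>i=1..n. of_bool (odd (?x i)) :: int) = int k"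
    by (simp add: k_def of_bool_def sum.If_cases Int_def)
  have "4 dvd (\<Sum>i=1..n. ?x i * ?x i - of_bool (odd (?x i)))"
    by (rule dvd_sum) (rule sq)
  then have 1: "4 dvd (\<Sum>i=1..n. ?x i * ?x i) - int k"
    by (simp only: sum_subtractf k)
  have "even (\<Sum>i=1..n. ?x i - of_bool (odd (?x i)))"
    by (rule dvd_sum) auto
  then have "even ((\<Sum>i=1..n. ?x i) - int k)"
    by (simp only: sum_subtractf k)
  then have "odd (?x 0) \<longleftrightarrow> odd k"
    using v by (simp add: dP_L_alt)
  then have 2: "4 dvd ?x 0 * ?x 0 - of_bool (odd k)"
    using sq[of "?x 0"] by simp
  have "dP_form n v v mod 4 = (int k - of_bool (odd k)) mod 4"
  proof -
    have "4 dvd dP_form n v v - (int k - of_bool (odd k))"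
      using dvd_diff[OF 1 2] by (simp add: dP_form_def algebra_simps)
    then show ?thesis by (simp add: mod_eq_dvd_iff)
  qed
  moreover have "odd (dP_form n v v div 2) \<longleftrightarrow> dP_form n v v mod 4 = 2"
    using dP_form_even[OF v] by presburger
  moreover have "(int k - of_bool (odd k)) mod 4 = 2 \<longleftrightarrow> k mod 4 \<in> {2, 3}"
    by (cases "odd k") (simp_all, presburger+)
  ultimately show ?thesis by simp
qed

text \<open>The hypothesis on \<open>w\<close> excludes the radical of the reduced form. It is needed only for \<open>n = 7\<close>,
  where the class of vectors with all coordinates odd has \<open>q = 1\<close> but contains no root.\<close>

lemma exists_dP_root_in_coset:
  assumes "n \<le> 8" and v: "v \<in> dP_L n" and q: "odd (dP_form n v v div 2)"
    and w: "w \<in> dP_L n" and vw: "odd (dP_form n v w)"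
  shows "\<exists>r \<in> dP_L n. dP_form n r r = 2 \<and> dP_coset n r = dP_coset n v"
proof -
  let ?x = "Poly_Mapping.lookup v"
  define S where "S = {i \<in> {1..n}. odd (?x i)}"
  have S: "S \<subseteq> {1..n}" "finite S" by (auto simp: S_def)
  have mem_S: "even (?x i) \<longleftrightarrow> i \<notin> S" if "i \<in> {1..n}" for i
    using that by (simp add: S_def)
  have "card S \<le> n"
    using card_mono[OF _ S(1)] by simp
  moreover have "card S mod 4 \<in> {2, 3}"
    using odd_dP_form_half_iff[OF v] q by (simp add: S_def)
  moreover have "k = 2 \<or> (k = 3 \<or> k = 6) \<or> k = 7" if "k \<le> 8" "k mod 4 = 2 \<or> k mod 4 = 3" for k :: nat
    using that by presburger
  from this[of "card S"] calculation consider "card S = 2" | "card S = 3 \<or> card S = 6" | "card S = 7"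
    using \<open>n \<le> 8\<close> by force
  then show ?thesis
  proof cases
    case 1
    then obtain i j where ij: "S = {i, j}" "i \<noteq> j" by (meson card_2_iff)
    then have mem: "i \<in> {1..n}" "j \<in> {1..n}" using S by auto
    \<comment> \<open>The root \<open>E_i - E_j\<close>, with coordinate 0 equal to 0.\<close>
    let ?y = "\<lambda>m. of_bool (m = i) - of_bool (m = j) :: int"
    have sum: "(\<Sum>m=1..n. ?y m) = - 3 * 0"
      using mem by (simp add: sum_subtractf of_bool_def)
    have sq: "(\<Sum>m=1..n. ?y m * ?y m) = 0 * 0 + 2"
    proof -
      have "(\<Sum>m=1..n. ?y m * ?y m) = (\<Sum>m=1..n. of_bool (m = i) + of_bool (m = j))"
        using ij(2) by (intro sum.cong) auto
      also have "\<dots> = 0 * 0 + 2"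
        using mem by (simp add: sum.distrib of_bool_def)
      finally show ?thesis .
    qed
    have par: "even (?y m) \<longleftrightarrow> even (?x m)" if "m \<in> {1..n}" for m
      unfolding mem_S[OF that] ij(1) using ij(2) by auto
    show ?thesis
      by (rule exists_dP_root_if_coords[OF v sum sq par])
  next
    case 2
    \<comment> \<open>The roots \<open>E_0 - E_i - E_j - E_k\<close> for three indices and
      \<open>2 E_0\<close> minus the sum of the six \<open>E_i\<close> for six; coordinate 0 is
      \<open>card S div 3\<close>.\<close>
    let ?y = "\<lambda>m. - of_bool (m \<in> S) :: int"
    have "{1..n} \<inter> S = S" using S by auto
    then have "(\<Sum>m=1..n. of_bool (m \<in> S) :: int) = int (card S)"
      by (simp add: of_bool_def sum.If_cases)
    moreover have "(\<Sum>m=1..n. ?y m * ?y m) = (\<Sum>m=1..n. of_bool (m \<in> S))"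
      by (intro sum.cong) auto
    ultimately have sums: "(\<Sum>m=1..n. ?y m) = - int (card S)" "(\<Sum>m=1..n. ?y m * ?y m) = int (card S)"
      by (simp_all only: sum_negf)
    show ?thesis
    proof (rule exists_dP_root_if_coords[OF v])
      show "(\<Sum>m=1..n. ?y m) = - 3 * (int (card S) div 3)"
        using 2 unfolding sums by auto
      show "(\<Sum>m=1..n. ?y m * ?y m) = (int (card S) div 3) * (int (card S) div 3) + 2"
        using 2 unfolding sums by auto
    qed (simp add: mem_S)
  next
    case 3
    then consider "n = 7" | "n = 8"
      using \<open>card S \<le> n\<close> \<open>n \<le> 8\<close> by linarith
    then show ?thesis
    proof cases
      case 1
      \<comment> \<open>All coordinates of \<open>v\<close> are odd, coordinate 0 included, so
        \<open>v\<close> is congruent to \<open>dP_K n\<close> modulo 2. It therefore pairs evenly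
        with every lattice vector, against \<open>vw\<close>.\<close>
      then have S_eq: "S = {1..n}"
        using 3 S by (intro card_subset_eq) auto
      have odds: "odd (?x i)" if "i \<in> {1..n}" for i
        using mem_S[OF that] that unfolding S_eq by blast
      have "even (\<Sum>i=1..n. ?x i) \<longleftrightarrow> even (card S)"
        unfolding S_def by (rule even_sum_iff) simp
      then have "odd (?x 0)"
        using v 3 by (simp add: dP_L_alt)
      have "even (\<Sum>i=1..n. ?x i * Poly_Mapping.lookup w i - Poly_Mapping.lookup w i)"
        by (rule dvd_sum) (use odds in auto)
      then have "even ((\<Sum>i=1..n. ?x i * Poly_Mapping.lookup w i) - (\<Sum>i=1..n. Poly_Mapping.lookup w i))"
        by (simp add: sum_subtractf)
      then have "even (dP_form n v w)"
        using w \<open>odd (?x 0)\<close> by (simp add: dP_L_alt dP_form_def)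
      with vw show ?thesis by simp
    next
      case 2
      \<comment> \<open>The root \<open>3 E_0\<close> minus the seven \<open>E_i\<close> with
        \<open>i\<close> in \<open>S\<close> and minus twice the remaining one: the sum is -9 and
        the squares add up to 7 + 4 = 9 + 2.\<close>
      let ?y = "\<lambda>m. if m \<in> S then - 1 else - 2 :: int"
      have "{1..n} \<inter> S = S" "{1..n} \<inter> - S = {1..n} - S" using S by auto
      moreover have "card ({1..n} - S) = 1"
        using S 2 3 by (simp add: card_Diff_subset)
      ultimately have if_sum: "(\<Sum>m=1..n. if m \<in> S then a else b) = 7 * a + b" for a b :: int
        using 3 by (simp add: sum.If_cases)
      have "(\<Sum>m=1..n. ?y m * ?y m) = (\<Sum>m=1..n. if m \<in> S then 1 else 4)"
        by (intro sum.cong) auto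
      then have sq: "(\<Sum>m=1..n. ?y m * ?y m) = 3 * 3 + 2"
        unfolding if_sum by simp
      have sum: "(\<Sum>m=1..n. ?y m) = - 3 * 3"
        unfolding if_sum by simp
      show ?thesis
        by (rule exists_dP_root_if_coords[OF v sum sq]) (simp add: mem_S)
    qed
  qed
qed

text \<open>Write \<open>r = s + 2u\<close>. Equality of norms gives \<open>s.u = - u.u\<close>,
  hence \<open>(r + s)^2 = 8 - 4 u^2\<close>. Positivity and evenness leave \<open>u^2 = 0\<close>,
  where \<open>u = 0\<close>, or \<open>u^2 = 2\<close>, where \<open>r + s = 0\<close>.\<close>

lemma dP_congruent_roots:
  assumes "n \<le> 8" and r: "r \<in> dP_L n" "dP_form n r r = 2" and s: "s \<in> dP_L n" "dP_form n s s = 2"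
    and "dP_coset n r = dP_coset n s"
  shows "r = s \<or> r = - s"
proof -
  obtain u where u: "u \<in> dP_L n" "r = s + frag_cmul 2 u"
    using assms dP_coset_eq_iff by blast
  have "dP_form n r r = dP_form n s s + 4 * dP_form n s u + 4 * dP_form n u u"
    unfolding u(2) by (simp add: dP_form_add_left dP_form_add_right dP_form_cmul_left
        dP_form_cmul_right dP_form_sym[of n u s])
  then have su: "dP_form n s u = - dP_form n u u"
    using r s by simp
  have "dP_form n r s = 2 - 2 * dP_form n u u"
    unfolding u(2) using s su by (simp add: dP_form_add_left dP_form_cmul_left dP_form_sym[of n u s])
  then have rs: "dP_form n (r + s) (r + s) = 8 - 4 * dP_form n u u"
    using r s by (simp only: dP_form_add_left dP_form_add_right dP_form_sym[of n s r])
  then have "dP_form n u u \<le> 2"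
    using dP_form_nonneg[OF dP_L_add[OF r(1) s(1)] \<open>n \<le> 8\<close>] by simp
  moreover have "even (dP_form n u u)" "0 \<le> dP_form n u u"
    using u \<open>n \<le> 8\<close> by (auto simp: dP_form_even dP_form_nonneg)
  ultimately consider "dP_form n u u = 0" | "dP_form n u u = 2" by fastforce
  then show ?thesis
  proof cases
    case 1
    then show ?thesis
      using dP_form_eq_0_imp[OF u(1) \<open>n \<le> 8\<close>] u(2) by simp
  next
    case 2
    then show ?thesis
      using dP_form_eq_0_imp[OF dP_L_add[OF r(1) s(1)] \<open>n \<le> 8\<close>] rs by (simp add: eq_neg_iff_add_eq_0)
  qed
qed

section \<open>Simple roots as a basis of the lattice\<close>

text \<open>The indices \<open>1, ..., n - 1\<close> form a chain and 0 is attached to 3. For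
  \<open>n\<close> from 4 to 8 the diagrams are A4, D5, E6, E7, E8.\<close>

definition dP_simple_root :: "nat \<Rightarrow> (nat \<Rightarrow>\<^sub>0 int)" where
  "dP_simple_root i = (if i = 0 then frag_of 0 - frag_of 1 - frag_of 2 - frag_of 3
     else frag_of i - frag_of (Suc i))"

text \<open>Each edge of the Dynkin diagram is listed in one direction only, so that a sign
  condition is imposed once per edge.\<close>

definition dP_adjacent :: "nat \<Rightarrow> nat \<Rightarrow> bool" where
  "dP_adjacent i j \<longleftrightarrow> (1 \<le> i \<and> j = Suc i) \<or> (i = 0 \<and> j = 3)"

lemma lookup_dP_simple_root:
  "Poly_Mapping.lookup (dP_simple_root i) k =
    (if i = 0 then of_bool (k = 0) - of_bool (k \<in> {1, 2, 3}) else of_bool (k = i) - of_bool (k = Suc i))"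
  by (auto simp: dP_simple_root_def lookup_minus lookup_single when_def)

lemma dP_form_simple_root:
  assumes "4 \<le> n" "i < n" "j < n"
  shows "dP_form n (dP_simple_root i) (dP_simple_root j) =
    (if i = j then 2 else if dP_adjacent i j \<or> dP_adjacent j i then - 1 else 0)"
  using assms
  by (cases "i = 0"; cases "j = 0")
     (auto simp: dP_simple_root_def dP_form_diff_left dP_form_diff_right dP_form_basis dP_adjacent_def)

lemma dP_simple_root_in_L:
  assumes "4 \<le> n" "i < n"
  shows "dP_simple_root i \<in> dP_L n"
proof -
  have "dP_form n (dP_simple_root i) (dP_K n) = 0"
  proof -
    have K: "dP_form n (frag_of k) (dP_K n) = (if k = 0 then - 3 else - 1)" if "k \<le> n" for k
    proof -
      have "(\<Sum>i=1..n. dP_form n (frag_of k) (frag_of i)) = (\<Sum>i=1..n. if i = k then 1 else 0)"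
        using that by (intro sum.cong) (auto simp: dP_form_basis)
      then show ?thesis
        using that by (simp add: dP_K_def dP_form_diff_right dP_form_cmul_right dP_form_sum_right dP_form_basis)
    qed
    show ?thesis
      using assms by (simp add: dP_simple_root_def dP_form_diff_left K)
  qed
  moreover have "Poly_Mapping.keys (dP_simple_root i) \<subseteq> {0..n}"
    using assms by (auto simp: in_keys_iff lookup_dP_simple_root of_bool_def split: if_splits)
  ultimately show ?thesis by (simp add: dP_L_iff)
qed

text \<open>The odd pairing with a neighbour shows that the class of a simple root lies outside the
  radical; an isometry carries this over to its image, as \<open>exists_dP_root_in_coset\<close>
  requires.\<close>

lemma dP_simple_root_neighbour:
  assumes "4 \<le> n" "i < n"
  obtains j where "j < n" "dP_form n (dP_simple_root i) (dP_simple_root j) = - 1"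
proof -
  have "\<exists>j<n. dP_adjacent i j \<or> dP_adjacent j i"
    using assms
    by (cases "i = 0"; cases "Suc i = n")
       (auto simp: dP_adjacent_def intro: exI[of _ 3] exI[of _ "Suc i"] exI[of _ "i - 1"])
  then show thesis
    using that dP_form_simple_root[OF assms] assms by (force simp: dP_adjacent_def)
qed

text \<open>Comparing coordinate \<open>k\<close> in the expansion over the simple roots gives a
  triangular system: \<open>c_k\<close> equals \<open>c_(k-1)\<close> plus \<open>x_k\<close>, plus
  \<open>x_0\<close> if \<open>k \<le> 3\<close>. The formula is its solution by partial
  sums.\<close>

definition dP_coeff :: "(nat \<Rightarrow>\<^sub>0 int) \<Rightarrow> nat \<Rightarrow> int" where
  "dP_coeff v i = (if i = 0 then Poly_Mapping.lookup v 0
     else (\<Sum>j=1..i. Poly_Mapping.lookup v j) + int (min i 3) * Poly_Mapping.lookup v 0)"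

lemma dP_coeff_add: "dP_coeff (v + w) i = dP_coeff v i + dP_coeff w i"
  by (simp add: dP_coeff_def lookup_add sum.distrib algebra_simps)

lemma dP_simple_root_expansion:
  assumes n: "4 \<le> n" and v: "v \<in> dP_L n"
  shows "v = (\<Sum>i<n. frag_cmul (dP_coeff v i) (dP_simple_root i))"
proof (rule poly_mapping_eqI)
  fix k
  let ?c = "dP_coeff v"
  have "Poly_Mapping.lookup (\<Sum>i<n. frag_cmul (?c i) (dP_simple_root i)) k
      = (\<Sum>i\<in>insert 0 {1..<n}. ?c i * Poly_Mapping.lookup (dP_simple_root i) k)"
  proof -
    have "{..<n} = insert 0 {1..<n}" using n by auto
    then show ?thesis by (simp only: lookup_sum lookup_frag_cmul)
  qed
  also have "\<dots> = ?c 0 * (of_bool (k = 0) - of_bool (k \<in> {1, 2, 3}))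
      + (\<Sum>i=1..<n. ?c i * (of_bool (k = i) - of_bool (k = Suc i)))"
    by (subst sum.insert) (auto simp: lookup_dP_simple_root intro!: sum.cong)
  also have "(\<Sum>i=1..<n. ?c i * (of_bool (k = i) - of_bool (k = Suc i)))
      = (\<Sum>i=1..<n. if k = i then ?c i else 0) - (\<Sum>i=1..<n. if k - 1 = i \<and> k \<noteq> 0 then ?c i else 0)"
    unfolding sum_subtractf[symmetric] by (rule sum.cong) auto
  also have "\<dots> = (if k \<in> {1..<n} then ?c k else 0) - (if k - 1 \<in> {1..<n} then ?c (k - 1) else 0)"
    by (cases k) (auto simp: sum.delta)
  finally have eq: "Poly_Mapping.lookup (\<Sum>i<n. frag_cmul (?c i) (dP_simple_root i)) k
    = ?c 0 * (of_bool (k = 0) - of_bool (k \<in> {1, 2, 3}))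
      + ((if k \<in> {1..<n} then ?c k else 0) - (if k - 1 \<in> {1..<n} then ?c (k - 1) else 0))" .
  consider "k = 0" | "k = 1" | "k \<in> {2..<n}" | "k = n" | "n < k"
    by force
  then show "Poly_Mapping.lookup v k
      = Poly_Mapping.lookup (\<Sum>i<n. frag_cmul (?c i) (dP_simple_root i)) k"
  proof cases
    case 1
    show ?thesis
      unfolding eq unfolding 1 by (simp add: dP_coeff_def)
  next
    case 2
    show ?thesis
      unfolding eq unfolding 2 using n by (simp add: dP_coeff_def)
  next
    case 3
    then obtain m where m: "k = Suc m" "1 \<le> m"
      by (metis Suc_le_D Suc_le_mono atLeastLessThan_iff numeral_2_eq_2 One_nat_def)
    then show ?thesis
      unfolding eq using 3 by (auto simp: dP_coeff_def min_def algebra_simps)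
  next
    case 4
    then obtain m where m: "k = Suc m" "3 \<le> m"
      using n by (cases k) auto
    \<comment> \<open>The last coordinate is where orthogonality to \<open>dP_K n\<close> enters: it
      turns minus the coefficient at \<open>n - 1\<close> into the coordinate at \<open>n\<close>.
      The earlier coordinates agree by telescoping.\<close>
    have "(\<Sum>j=1..Suc m. Poly_Mapping.lookup v j) = - 3 * Poly_Mapping.lookup v 0"
      using v 4 m by (simp add: dP_L_alt)
    then show ?thesis
      unfolding eq using 4 m by (auto simp: dP_coeff_def algebra_simps)
  next
    case 5
    then show ?thesis
      unfolding eq using n dP_L_lookup_eq_0[OF v] by auto
  qed
qed

section \<open>Lifting isometries of the reduction\<close>

text \<open>Closure under sums and negation gives closure under integer combinations. Together with
  the expansion over simple roots, this reduces a claim about all lattice vectors to the simple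
  roots.\<close>

lemma additive_relation_sum_cmul:
  assumes zero: "R 0 0"
    and add: "\<And>v w v' w'. R v w \<Longrightarrow> R v' w' \<Longrightarrow> R (v + v') (w + w')"
    and minus: "\<And>v w. R v w \<Longrightarrow> R (- v) (- w)"
    and R: "\<And>i. i \<in> A \<Longrightarrow> R (x i) (y i)"
  shows "R (\<Sum>i\<in>A. frag_cmul (c i) (x i)) (\<Sum>i\<in>A. frag_cmul (c i) (y i))"
proof -
  have nat: "R (frag_cmul (int m) v) (frag_cmul (int m) w)" if "R v w" for m v w
    by (induction m) (use that zero add in \<open>auto simp: frag_cmul_distrib\<close>)
  have cmul: "R (frag_cmul k v) (frag_cmul k w)" if "R v w" for k v w
    using nat[OF that] minus[OF nat[OF that]] by (cases k rule: int_cases2) auto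
  show ?thesis
    using R by (induction A rule: infinite_finite_induct) (auto simp: zero intro!: add cmul)
qed

lemma of_int_bit_eq_iff: "(of_int a :: bit) = of_int b \<longleftrightarrow> (even a \<longleftrightarrow> even b)"
  by (metis Z2.bit_eq_iff even_of_int_iff)

text \<open>The pairing modulo 2 is the polarization \<open>q(a + b) - q(a) - q(b)\<close>, so an
  additive map preserving \<open>q\<close> preserves it. Everything is phrased with representatives
  because \<open>g\<close> acts on classes.\<close>

lemma dP_O_mod2_parity:
  assumes g: "g \<in> carrier (dP_O_mod2 n)"
    and L: "v \<in> dP_L n" "w \<in> dP_L n" "v' \<in> dP_L n" "w' \<in> dP_L n"
    and gv: "g (dP_coset n v) = dP_coset n v'" and gw: "g (dP_coset n w) = dP_coset n w'"
  shows "even (dP_form n v' v' div 2) \<longleftrightarrow> even (dP_form n v v div 2)"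
    and "g (dP_coset n (v + w)) = dP_coset n (v' + w')"
    and "even (dP_form n v' w') \<longleftrightarrow> even (dP_form n v w)"
proof -
  have mem: "dP_coset n u \<in> carrier (dP_mod2 n)" if "u \<in> dP_L n" for u
    using that by (auto simp: dP_mod2_carrier)
  have q: "even (dP_form n u' u' div 2) \<longleftrightarrow> even (dP_form n u u div 2)"
    if "u \<in> dP_L n" "u' \<in> dP_L n" "g (dP_coset n u) = dP_coset n u'" for u u'
  proof -
    have "dP_quad n (g (dP_coset n u)) = dP_quad n (dP_coset n u)"
      using g mem[OF that(1)] unfolding dP_O_mod2_carrier by blast
    then show ?thesis
      using that by (simp add: dP_quad_coset of_int_bit_eq_iff)
  qed
  have "g \<in> hom (dP_mod2 n) (dP_mod2 n)"
    using g by (simp add: dP_O_mod2_carrier auto_def)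
  from hom_mult[OF this mem[OF L(1)] mem[OF L(2)]]
  show add: "g (dP_coset n (v + w)) = dP_coset n (v' + w')"
    by (simp only: gv gw dP_mult_coset L)
  show "even (dP_form n v' v' div 2) \<longleftrightarrow> even (dP_form n v v div 2)"
    using q L gv by blast
  have half: "dP_form n (a + b) (a + b) div 2 = dP_form n a a div 2 + dP_form n b b div 2 + dP_form n a b"
    if "a \<in> dP_L n" "b \<in> dP_L n" for a b
  proof -
    have "dP_form n (a + b) (a + b) = dP_form n a a + dP_form n b b + 2 * dP_form n a b"
      by (simp add: dP_form_add_left dP_form_add_right dP_form_sym[of n b a])
    with dP_form_even[OF that(1)] dP_form_even[OF that(2)] show ?thesis by auto
  qed
  show "even (dP_form n v' w') \<longleftrightarrow> even (dP_form n v w)"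
    using q[OF dP_L_add[OF L(1,2)] dP_L_add[OF L(3,4)] add] q[OF L(1,3) gv] q[OF L(2,4) gw]
    by (simp add: half L) blast
qed

lemma dP_O_mod2_coset_zero:
  assumes g: "g \<in> carrier (dP_O_mod2 n)"
  shows "g (dP_coset n 0) = dP_coset n 0"
proof -
  have "g \<in> hom (dP_mod2 n) (dP_mod2 n)"
    using g by (simp add: dP_O_mod2_carrier auto_def)
  then have "g \<one>\<^bsub>dP_mod2 n\<^esub> = \<one>\<^bsub>dP_mod2 n\<^esub>"
    using hom_one group_dP_mod2 by blast
  moreover have "\<one>\<^bsub>dP_mod2 n\<^esub> = dP_coset n 0"
    unfolding dP_coset_eq by (auto simp: dP_mod2_def FactGroup_def dP_double_iff)
  ultimately show ?thesis by simp
qed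

text \<open>The diagram has no cycles, so signs can be chosen node by node: start with 1 at node 1,
  follow the chain, then choose node 0 from node 3.\<close>

lemma exists_dP_tree_signs:
  fixes b :: "nat \<Rightarrow> nat \<Rightarrow> int"
  assumes "4 \<le> n" and b: "\<And>i j. i < n \<Longrightarrow> j < n \<Longrightarrow> dP_adjacent i j \<Longrightarrow> \<bar>b i j\<bar> = 1"
  obtains s :: "nat \<Rightarrow> int" where "\<And>i. i < n \<Longrightarrow> s i * s i = 1"
    "\<And>i j. i < n \<Longrightarrow> j < n \<Longrightarrow> dP_adjacent i j \<Longrightarrow> s i * s j * b i j = - 1"
proof -
  have sq: "a * a = 1" if "\<bar>a\<bar> = 1" for a :: int
    using that by (auto simp: abs_if split: if_splits)
  \<comment> \<open>\<open>t 1\<close> is the empty product 1. Passing the edge from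
    \<open>j\<close> to \<open>Suc j\<close> multiplies by \<open>- b j (Suc j)\<close>, so the
    signed value on that edge is minus a product of squares of signs, that is -1.\<close>
  define t where "t i = (\<Prod>j=1..<i. - b j (Suc j))" for i
  have t_sq: "t i * t i = 1" if "i < n" for i
  proof -
    have "t i * t i = (\<Prod>j=1..<i. b j (Suc j) * b j (Suc j))"
      unfolding t_def prod.distrib[symmetric] by simp
    also have "\<dots> = 1"
      using that by (intro prod.neutral ballI sq b) (auto simp: dP_adjacent_def)
    finally show ?thesis .
  qed
  define s where "s i = (if i = 0 then - b 0 3 * t 3 else t i)" for i
  have b03: "b 0 3 * b 0 3 = 1"
    using assms by (intro sq b) (auto simp: dP_adjacent_def)
  have s_sq: "s i * s i = 1" if "i < n" for i
  proof (cases "i = 0")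
    case True
    have "s i * s i = (b 0 3 * b 0 3) * (t 3 * t 3)"
      by (simp add: True s_def)
    then show ?thesis
      using b03 t_sq[of 3] assms by simp
  qed (use that t_sq in \<open>simp add: s_def\<close>)
  moreover have "s i * s j * b i j = - 1" if "i < n" "j < n" "dP_adjacent i j" for i j
  proof (cases "i = 0")
    case True
    then have "s i * s j * b i j = - ((b 0 3 * b 0 3) * (t 3 * t 3))"
      using that by (simp add: dP_adjacent_def s_def)
    then show ?thesis
      using b03 t_sq[of 3] assms by simp
  next
    case False
    then have j: "j = Suc i"
      using that by (simp add: dP_adjacent_def)
    have "s i * s j * b i j = - ((t i * t i) * (b i j * b i j))"
      using False by (simp add: s_def t_def j prod.atLeastLessThan_Suc)
    then show ?thesis
      using t_sq[OF that(1)] sq[OF b[OF that]] by simp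
  qed
  ultimately show thesis
    using that by blast
qed

lemma dP_form_sum_cmul:
  "dP_form n (\<Sum>i\<in>A. frag_cmul (c i) (x i)) (\<Sum>j\<in>B. frag_cmul (d j) (y j))
    = (\<Sum>i\<in>A. \<Sum>j\<in>B. c i * (d j * dP_form n (x i) (y j)))"
  unfolding dP_form_sum_left unfolding dP_form_sum_right
  by (simp add: dP_form_cmul_left dP_form_cmul_right mult.left_commute)

lemma dP_L_sum_cmul:
  "(\<And>i. i \<in> A \<Longrightarrow> x i \<in> dP_L n) \<Longrightarrow> (\<Sum>i\<in>A. frag_cmul (c i) (x i)) \<in> dP_L n"
  by (induction A rule: infinite_finite_induct) (auto simp: dP_L_zero dP_L_add dP_L_cmul)

text \<open>A vector in the kernel has norm 0, so positivity gives injectivity. Then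
  \<open>f\<close> injects the finite set of vectors of each norm into itself, hence permutes it;
  this replaces a determinant computation.\<close>

lemma dP_isometry_bij:
  assumes "n \<le> 8" and L: "\<And>v. v \<in> dP_L n \<Longrightarrow> f v \<in> dP_L n"
    and add: "\<And>v w. v \<in> dP_L n \<Longrightarrow> w \<in> dP_L n \<Longrightarrow> f (v + w) = f v + f w"
    and form: "\<And>v. v \<in> dP_L n \<Longrightarrow> dP_form n (f v) (f v) = dP_form n v v"
  shows "bij_betw f (dP_L n) (dP_L n)"
proof -
  have inj: "inj_on f (dP_L n)"
  proof (rule inj_onI)
    fix v w assume v: "v \<in> dP_L n" and w: "w \<in> dP_L n" and "f v = f w"
    then have "f (v - w) = 0"
      using add[OF dP_L_diff[OF v w] w] by simp
    then have "dP_form n (v - w) (v - w) = 0"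
      using form[OF dP_L_diff[OF v w]] by (simp add: dP_form_zero_left)
    then show "v = w"
      using dP_form_eq_0_imp[OF dP_L_diff[OF v w] \<open>n \<le> 8\<close>] by simp
  qed
  have "v \<in> f ` dP_L n" if "v \<in> dP_L n" for v
  proof -
    let ?A = "{u \<in> dP_L n. dP_form n u u = dP_form n v v}"
    have "f ` ?A = ?A"
      by (rule endo_inj_surj) (use finite_dP_form_eq[OF \<open>n \<le> 8\<close>] L form inj in \<open>auto intro: inj_on_subset\<close>)
    with that show ?thesis by blast
  qed
  with inj L show ?thesis
    by (auto simp: bij_betw_def)
qed

text \<open>The linear extension of sending simple roots to the \<open>r i\<close> preserves the
  form because the Gram matrices agree. Its surjectivity comes from
  \<open>dP_isometry_bij\<close>.\<close>

lemma exists_dP_isometry_of_frame: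
  assumes n: "4 \<le> n" "n \<le> 8" and L: "\<And>i. i < n \<Longrightarrow> r i \<in> dP_L n"
    and gram: "\<And>i j. i < n \<Longrightarrow> j < n \<Longrightarrow>
      dP_form n (r i) (r j) = dP_form n (dP_simple_root i) (dP_simple_root j)"
  shows "\<exists>f \<in> carrier (dP_O n). \<forall>v \<in> dP_L n. f v = (\<Sum>i<n. frag_cmul (dP_coeff v i) (r i))"
proof -
  define f where "f = (\<lambda>v \<in> dP_L n. \<Sum>i<n. frag_cmul (dP_coeff v i) (r i))"
  have f: "f v = (\<Sum>i<n. frag_cmul (dP_coeff v i) (r i))" if "v \<in> dP_L n" for v
    using that by (simp add: f_def)
  have fL: "f v \<in> dP_L n" if "v \<in> dP_L n" for v
    unfolding f[OF that] by (rule dP_L_sum_cmul) (use L in auto)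
  have add: "f (v + w) = f v + f w" if "v \<in> dP_L n" "w \<in> dP_L n" for v w
    using that by (simp add: f dP_L_add dP_coeff_add frag_cmul_distrib sum.distrib)
  have form: "dP_form n (f v) (f w) = dP_form n v w" if "v \<in> dP_L n" "w \<in> dP_L n" for v w
  proof -
    have "dP_form n (f v) (f w) = dP_form n (\<Sum>i<n. frag_cmul (dP_coeff v i) (dP_simple_root i))
        (\<Sum>i<n. frag_cmul (dP_coeff w i) (dP_simple_root i))"
      unfolding f[OF that(1)] f[OF that(2)] dP_form_sum_cmul using gram by (intro sum.cong) auto
    then show ?thesis
      unfolding dP_simple_root_expansion[OF n(1) that(1), symmetric]
        dP_simple_root_expansion[OF n(1) that(2), symmetric] .
  qed
  have "f \<in> carrier (dP_O n)"
    using dP_isometry_bij[OF n(2), of f] fL add form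
    by (auto simp: dP_O_carrier auto_def Bij_def hom_def f_def)
  with f show ?thesis by blast
qed

lemma dP_rho_surj:
  assumes n: "4 \<le> n" "n \<le> 8" and g: "g \<in> carrier (dP_O_mod2 n)"
  shows "\<exists>f \<in> carrier (dP_O n). dP_rho n f = g"
proof -
  let ?a = dP_simple_root
  have ga: "g \<in> auto (dP_mod2 n)"
    using g by (simp add: dP_O_mod2_carrier)
  have mem: "dP_coset n u \<in> carrier (dP_mod2 n)" if "u \<in> dP_L n" for u
    using that by (auto simp: dP_mod2_carrier)
  have image: "\<exists>u' \<in> dP_L n. g (dP_coset n u) = dP_coset n u'" if "u \<in> dP_L n" for u
    using auto_mem[OF ga mem[OF that]] by (simp add: dP_mod2_carrier)
  have aL: "?a i \<in> dP_L n" if "i < n" for i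
    using dP_simple_root_in_L[OF n(1) that] .
  have a2: "dP_form n (?a i) (?a i) = 2" if "i < n" for i
    using that n by (simp add: dP_form_simple_root)
  \<comment> \<open>The image class has q = 1, since a simple root has norm 2, and it pairs oddly
    with the image of a neighbour's class, so it contains a root.\<close>
  have "\<exists>b \<in> dP_L n. dP_form n b b = 2 \<and> dP_coset n b = g (dP_coset n (?a i))" if i: "i < n" for i
  proof -
    obtain j where j: "j < n" "dP_form n (?a i) (?a j) = - 1"
      using dP_simple_root_neighbour[OF n(1) i] by blast
    obtain u w where u: "u \<in> dP_L n" "g (dP_coset n (?a i)) = dP_coset n u"
      and w: "w \<in> dP_L n" "g (dP_coset n (?a j)) = dP_coset n w"
      using image aL i j by metis
    note par = dP_O_mod2_parity[OF g aL[OF i] aL[OF j(1)] u(1) w(1) u(2) w(2)]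
    have "odd (dP_form n u u div 2)" "odd (dP_form n u w)"
      using par(1,3) j a2[OF i] by simp_all
    then show ?thesis
      using exists_dP_root_in_coset[OF n(2) u(1) _ w(1)] u(2) by simp
  qed
  then obtain b where b: "b i \<in> dP_L n" "dP_form n (b i) (b i) = 2"
    "g (dP_coset n (?a i)) = dP_coset n (b i)" if "i < n" for i
    by metis
  have par: "even (dP_form n (b i) (b j)) \<longleftrightarrow> even (dP_form n (?a i) (?a j))" if "i < n" "j < n" for i j
    using dP_O_mod2_parity(3)[OF g aL aL b(1) b(1) b(3) b(3)] that by blast
  \<comment> \<open>A larger value would, by positivity, make one of \<open>b i + b j\<close> and
    \<open>b i - b j\<close> zero, so both roots would lie in one class. Injectivity of
    \<open>g\<close> then makes two distinct simple roots congruent, hence equal up to sign, against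
    their Gram matrix.\<close>
  have abs_le: "\<bar>dP_form n (b i) (b j)\<bar> \<le> 1" if ij: "i < n" "j < n" "i \<noteq> j" for i j
  proof (rule ccontr)
    assume "\<not> ?thesis"
    moreover have "0 \<le> dP_form n (b i + b j) (b i + b j)" "0 \<le> dP_form n (b i - b j) (b i - b j)"
      using b ij n dP_form_nonneg dP_L_add dP_L_diff by simp_all
    moreover have sq: "dP_form n (b i + b j) (b i + b j) = 4 + 2 * dP_form n (b i) (b j)"
      "dP_form n (b i - b j) (b i - b j) = 4 - 2 * dP_form n (b i) (b j)"
      using b ij by (simp_all add: dP_form_add_left dP_form_add_right dP_form_diff_left
          dP_form_diff_right dP_form_sym[of n "b j" "b i"])
    ultimately have "dP_form n (b i + b j) (b i + b j) = 0 \<or> dP_form n (b i - b j) (b i - b j) = 0"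
      by linarith
    then have "b i = - b j \<or> b i = b j"
      using dP_form_eq_0_imp[OF dP_L_add[OF b(1) b(1)] n(2), of i j]
        dP_form_eq_0_imp[OF dP_L_diff[OF b(1) b(1)] n(2), of i j] ij
      by (auto simp: eq_neg_iff_add_eq_0)
    then have "dP_coset n (b i) = dP_coset n (b j)"
      using b(1) ij dP_coset_minus by metis
    moreover have "inj_on g (carrier (dP_mod2 n))"
      using ga by (simp add: auto_def Bij_def bij_betw_def)
    ultimately have "dP_coset n (?a i) = dP_coset n (?a j)"
      using b(3) ij mem aL by (metis inj_onD)
    then have "?a i = ?a j \<or> ?a i = - ?a j"
      using dP_congruent_roots[OF n(2) aL a2 aL a2] ij by blast
    then have "\<bar>dP_form n (?a i) (?a j)\<bar> = 2"
      using a2 ij by (auto simp: dP_form_minus_left)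
    then show False
      using dP_form_simple_root[OF n(1) ij(1,2)] ij by (simp split: if_splits)
  qed
  have tree: "\<bar>dP_form n (b i) (b j)\<bar> = 1" if "i < n" "j < n" "dP_adjacent i j" for i j
  proof -
    have "i \<noteq> j" using that by (auto simp: dP_adjacent_def)
    moreover from this have "odd (dP_form n (b i) (b j))"
      using par that n by (simp add: dP_form_simple_root)
    ultimately show ?thesis
      using abs_le[OF that(1,2)] by (cases "dP_form n (b i) (b j) = 0") auto
  qed
  obtain s where
    s2: "\<And>i. i < n \<Longrightarrow> s i * s i = 1" and
    s: "\<And>i j. i < n \<Longrightarrow> j < n \<Longrightarrow> dP_adjacent i j \<Longrightarrow> s i * s j * dP_form n (b i) (b j) = - 1"
    by (rule exists_dP_tree_signs[OF n(1), of "\<lambda>i j. dP_form n (b i) (b j)"]) (use tree in blast)+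
  define r where "r i = frag_cmul (s i) (b i)" for i
  have rL: "r i \<in> dP_L n" if "i < n" for i
    using that b by (simp add: r_def dP_L_cmul)
  have gram: "dP_form n (r i) (r j) = dP_form n (?a i) (?a j)" if ij: "i < n" "j < n" for i j
  proof -
    have r: "dP_form n (r i) (r j) = s i * s j * dP_form n (b i) (b j)"
      by (simp add: r_def dP_form_cmul_left dP_form_cmul_right)
    consider "i = j" | "dP_adjacent i j" "i \<noteq> j" | "dP_adjacent j i" "i \<noteq> j"
      | "i \<noteq> j" "\<not> dP_adjacent i j" "\<not> dP_adjacent j i" by blast
    then show ?thesis
    proof cases
      case 1
      then show ?thesis
        unfolding r using a2[OF ij(1)] b(2)[OF ij(1)] s2[OF ij(1)] by simp
    next
      case 2
      then show ?thesis
        using s[OF ij] n ij by (simp add: r dP_form_simple_root)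
    next
      case 3
      then show ?thesis
        using s[OF ij(2,1)] n ij by (simp add: r dP_form_simple_root dP_form_sym[of n "b i" "b j"] mult.commute)
    next
      case 4
      then have "dP_form n (?a i) (?a j) = 0"
        using n ij by (simp add: dP_form_simple_root)
      \<comment> \<open>An even integer of absolute value at most 1 is 0, so no sign choice is
        involved off the edges.\<close>
      moreover from this have "dP_form n (b i) (b j) = 0"
        using par[OF ij] abs_le[OF ij 4(1)] by presburger
      ultimately show ?thesis by (simp add: r)
    qed
  qed
  have "\<exists>f \<in> carrier (dP_O n). \<forall>v \<in> dP_L n. f v = (\<Sum>i<n. frag_cmul (dP_coeff v i) (r i))"
    by (rule exists_dP_isometry_of_frame[OF n]) (use rL gram in blast)+
  then obtain f where f: "f \<in> carrier (dP_O n)"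
    "\<And>v. v \<in> dP_L n \<Longrightarrow> f v = (\<Sum>i<n. frag_cmul (dP_coeff v i) (r i))"
    by blast
  have fa: "f \<in> auto (del_Pezzo_lattice n)"
    using f by (simp add: dP_O_carrier)
  \<comment> \<open>Changing signs does not change classes modulo 2, so the adjusted roots still
    represent the images under \<open>g\<close>.\<close>
  have gr: "g (dP_coset n (?a i)) = dP_coset n (r i)" if "i < n" for i
  proof -
    have "s i = 1 \<or> s i = - 1"
      using s2[OF that] by (simp add: zmult_eq_1_iff)
    then have "r i = b i \<or> r i = - b i"
      by (auto simp: r_def)
    then show ?thesis
      using b(3)[OF that] dP_coset_minus[OF b(1)[OF that]] by metis
  qed
  \<comment> \<open>\<open>R\<close> says that \<open>w\<close> represents the image under
    \<open>g\<close> of the class of \<open>v\<close>. It is additive and holds between simple roots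
    and their lifts, so it holds between \<open>v\<close> and \<open>f v\<close>.\<close>
  define R where "R v w \<longleftrightarrow> v \<in> dP_L n \<and> w \<in> dP_L n \<and> g (dP_coset n v) = dP_coset n w" for v w
  have R: "R v (f v)" if v: "v \<in> dP_L n" for v
  proof -
    have "R (\<Sum>i<n. frag_cmul (dP_coeff v i) (?a i)) (\<Sum>i<n. frag_cmul (dP_coeff v i) (r i))"
    proof (rule additive_relation_sum_cmul[of R])
      show "R 0 0"
        using dP_O_mod2_coset_zero[OF g] by (simp add: R_def dP_L_zero)
      show "R (v + v') (w + w')" if "R v w" "R v' w'" for v w v' w'
        using that dP_O_mod2_parity(2)[OF g, of v v' w w'] by (simp add: R_def dP_L_add)
      show "R (- v) (- w)" if "R v w" for v w
        using that by (simp add: R_def dP_L_minus dP_coset_minus)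
      show "R (?a i) (r i)" if "i \<in> {..<n}" for i
        using that aL rL gr by (simp add: R_def)
    qed
    then show ?thesis
      unfolding f(2)[OF v] dP_simple_root_expansion[OF n(1) v, symmetric] .
  qed
  have "dP_rho n f = g"
  proof (rule extensionalityI)
    fix X assume "X \<in> carrier (dP_mod2 n)"
    then obtain v where v: "v \<in> dP_L n" "X = dP_coset n v"
      by (auto simp: dP_mod2_carrier)
    then show "dP_rho n f X = g X"
      using R[OF v(1)] dP_rho_coset[OF fa v(1)] by (simp add: R_def)
  qed (use ga in \<open>auto simp: dP_rho_def auto_def Bij_def\<close>)
  with f show ?thesis by blast
qed

section \<open>The kernel of \<open>dP_rho\<close> and the induced isomorphism\<close>

lemma frag_cmul_minus_right: "frag_cmul k (- v) = - frag_cmul k v"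
  by (rule poly_mapping_eqI) simp

lemma dP_rho_trivial_imp_pm1:
  assumes n: "4 \<le> n" "n \<le> 8" and f: "f \<in> carrier (dP_O n)"
    and triv: "\<And>v. v \<in> dP_L n \<Longrightarrow> dP_coset n (f v) = dP_coset n v"
  shows "f \<in> dP_pm1 n"
proof -
  let ?a = dP_simple_root
  have fa: "f \<in> auto (del_Pezzo_lattice n)"
    using f by (simp add: dP_O_carrier)
  have form: "dP_form n (f v) (f w) = dP_form n v w" if "v \<in> dP_L n" "w \<in> dP_L n" for v w
    using f that by (simp add: dP_O_carrier)
  have aL: "?a i \<in> dP_L n" if "i < n" for i
    using dP_simple_root_in_L[OF n(1) that] .
  define e :: "nat \<Rightarrow> int" where "e i = (if f (?a i) = ?a i then 1 else - 1)" for i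
  have e: "e i = 1 \<or> e i = - 1" "i < n \<Longrightarrow> f (?a i) = frag_cmul (e i) (?a i)" for i
  proof -
    show "e i = 1 \<or> e i = - 1" by (simp add: e_def)
    assume i: "i < n"
    have a2: "dP_form n (?a i) (?a i) = 2"
      using i n by (simp add: dP_form_simple_root)
    have "f (?a i) = ?a i \<or> f (?a i) = - ?a i"
      using dP_congruent_roots[OF n(2) auto_mem[OF fa aL[OF i]] _ aL[OF i] a2 triv[OF aL[OF i]]]
        form[OF aL[OF i] aL[OF i]] a2 by simp
    then show "f (?a i) = frag_cmul (e i) (?a i)"
      by (auto simp: e_def)
  qed
  \<comment> \<open>Preserving the pairing -1 along an edge forces the two signs to have product
    1.\<close>
  have adj: "e i = e j" if "i < n" "j < n" "dP_adjacent i j" for i j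
  proof -
    have "i \<noteq> j" using that by (auto simp: dP_adjacent_def)
    then have "dP_form n (?a i) (?a j) = - 1"
      using that n by (simp add: dP_form_simple_root)
    then have "e i * e j = 1"
      using form[OF aL[OF that(1)] aL[OF that(2)]] e(2) that
      by (simp add: dP_form_cmul_left dP_form_cmul_right mult.commute)
    then show ?thesis
      using e(1)[of i] e(1)[of j] by auto
  qed
  \<comment> \<open>The induction runs along the chain from node 1; node 0 is then reached through
    its neighbour 3.\<close>
  have chain: "Suc i < n \<Longrightarrow> e (Suc i) = e 1" for i
  proof (induction i)
    case (Suc i)
    then show ?case
      using adj[of "Suc i" "Suc (Suc i)"] by (simp add: dP_adjacent_def)
  qed simp
  have e1: "e i = e 1" if "i < n" for i
  proof (cases i)
    case 0
    then show ?thesis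
      using adj[of 0 3] chain[of 2] n by (simp add: dP_adjacent_def numeral_3_eq_3 numeral_2_eq_2)
  next
    case (Suc m)
    then show ?thesis
      using that chain[of m] by simp
  qed
  \<comment> \<open>The conjunct \<open>v = w\<close> makes the principle for relations work as one
    for a property of a single vector, here that \<open>f\<close> acts on it by the common sign
    \<open>e 1\<close>.\<close>
  define R where "R v w \<longleftrightarrow> v \<in> dP_L n \<and> f v = frag_cmul (e 1) w \<and> v = w" for v w
  have fv: "f v = frag_cmul (e 1) v" if v: "v \<in> dP_L n" for v
  proof -
    have "R (\<Sum>i<n. frag_cmul (dP_coeff v i) (?a i)) (\<Sum>i<n. frag_cmul (dP_coeff v i) (?a i))"
    proof (rule additive_relation_sum_cmul[of R])
      show "R 0 0"
        using auto_dP_add[OF fa dP_L_zero dP_L_zero] by (simp add: R_def dP_L_zero)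
      show "R (v + v') (w + w')" if "R v w" "R v' w'" for v w v' w'
        using that auto_dP_add[OF fa] by (auto simp: R_def dP_L_add frag_cmul_distrib2)
      show "R (- v) (- w)" if "R v w" for v w
        using that auto_dP_minus[OF fa] by (auto simp: R_def dP_L_minus frag_cmul_minus_right)
      show "R (?a i) (?a i)" if "i \<in> {..<n}" for i
        using that aL e(2)[of i] e1[of i] by (simp add: R_def)
    qed
    then show ?thesis
      unfolding R_def dP_simple_root_expansion[OF n(1) v, symmetric] by blast
  qed
  have ext: "f \<in> extensional (dP_L n)"
    using fa by (simp add: auto_def Bij_def)
  consider "e 1 = 1" | "e 1 = - 1"
    using e(1)[of 1] n by force
  then show ?thesis
  proof cases
    case 1
    have "f = (\<lambda>v \<in> dP_L n. v)"
      by (rule extensionalityI[OF ext]) (use fv 1 in auto)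
    then show ?thesis by (simp add: dP_pm1_def dP_O_one)
  next
    case 2
    have "f = (\<lambda>v \<in> dP_L n. - v)"
      by (rule extensionalityI[OF ext]) (use fv 2 in auto)
    then show ?thesis by (simp add: dP_pm1_def)
  qed
qed

lemma dP_O_mod2_one: "\<one>\<^bsub>dP_O_mod2 n\<^esub> = (\<lambda>X \<in> carrier (dP_mod2 n). X)"
  by (simp add: dP_O_mod2_def AutoGroup_def BijGroup_def)

lemma kernel_dP_rho:
  assumes "4 \<le> n" "n \<le> 8"
  shows "kernel (dP_O n) (dP_O_mod2 n) (dP_rho n) = dP_pm1 n"
proof (intro equalityI subsetI)
  fix f assume "f \<in> kernel (dP_O n) (dP_O_mod2 n) (dP_rho n)"
  then have f: "f \<in> carrier (dP_O n)" and one: "dP_rho n f = (\<lambda>X \<in> carrier (dP_mod2 n). X)"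
    by (simp_all add: kernel_def dP_O_mod2_one)
  show "f \<in> dP_pm1 n"
  proof (rule dP_rho_trivial_imp_pm1[OF assms f])
    fix v assume v: "v \<in> dP_L n"
    then have "dP_coset n v \<in> carrier (dP_mod2 n)"
      by (auto simp: dP_mod2_carrier)
    then show "dP_coset n (f v) = dP_coset n v"
      using dP_rho_coset[OF _ v, of f] f one by (simp add: dP_O_carrier)
  qed
next
  interpret normal "dP_pm1 n" "dP_O n" by (rule normal_dP_pm1)
  fix f assume pm: "f \<in> dP_pm1 n"
  then have f: "f \<in> carrier (dP_O n)" by (rule mem_carrier)
  have fv: "f v = v \<or> f v = - v" if "v \<in> dP_L n" for v
    using pm that by (auto simp: dP_pm1_def dP_O_one)
  have "dP_rho n f = \<one>\<^bsub>dP_O_mod2 n\<^esub>"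
    unfolding dP_O_mod2_one
  proof (rule extensionalityI)
    fix X assume X: "X \<in> carrier (dP_mod2 n)"
    then obtain v where v: "v \<in> dP_L n" "X = dP_coset n v"
      by (auto simp: dP_mod2_carrier)
    then have "dP_rho n f X = X"
      using fv[OF v(1)] dP_rho_coset[OF _ v(1), of f] f by (auto simp: dP_O_carrier dP_coset_minus)
    with X show "dP_rho n f X = (\<lambda>X \<in> carrier (dP_mod2 n). X) X" by simp
  qed (auto simp: dP_rho_def)
  with f show "f \<in> kernel (dP_O n) (dP_O_mod2 n) (dP_rho n)"
    by (simp add: kernel_def)
qed

text \<open>The values of \<open>h\<close> on cosets are prescribed, so it is the map induced by
  \<open>dP_rho\<close> and not merely some isomorphism between the two groups.\<close>

theorem proposition2:
  fixes n :: nat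
  assumes "4 \<le> n" and "n \<le> 8"
  shows "\<exists>h \<in> iso (dP_O n Mod dP_pm1 n) (dP_O_mod2 n).
           \<forall>f \<in> carrier (dP_O n). h (dP_pm1 n #>\<^bsub>dP_O n\<^esub> f) = dP_rho n f"
proof -
  interpret group_hom "dP_O n" "dP_O_mod2 n" "dP_rho n"
    by (simp add: group_hom_def group_hom_axioms_def group_dP_O group_dP_O_mod2 dP_rho_hom)
  note ker = kernel_dP_rho[OF assms]
  have "dP_rho n ` carrier (dP_O n) = carrier (dP_O_mod2 n)"
    using dP_rho_surj[OF assms] dP_rho_closed by blast
  \<comment> \<open>First isomorphism theorem, with the kernel rewritten as \<open>dP_pm1 n\<close>.
    The direct image of a coset of the kernel is a singleton, whose element \<open>the_elem\<close>
    extracts.\<close>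
  then have iso: "(\<lambda>X. the_elem (dP_rho n ` X)) \<in> iso (dP_O n Mod dP_pm1 n) (dP_O_mod2 n)"
    by (rule FactGroup_iso_set[unfolded ker])
  have coset: "the_elem (dP_rho n ` (dP_pm1 n #>\<^bsub>dP_O n\<^esub> f)) = dP_rho n f"
    if f: "f \<in> carrier (dP_O n)" for f
  proof (rule the_elem_image_unique)
    show "dP_pm1 n #>\<^bsub>dP_O n\<^esub> f \<noteq> {}"
      by (auto simp: r_coset_def dP_pm1_def)
    fix x assume "x \<in> dP_pm1 n #>\<^bsub>dP_O n\<^esub> f"
    then obtain k where k: "k \<in> kernel (dP_O n) (dP_O_mod2 n) (dP_rho n)" "x = k \<otimes>\<^bsub>dP_O n\<^esub> f"
      unfolding ker by (auto simp: r_coset_def)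
    then have "k \<in> carrier (dP_O n)" "dP_rho n k = \<one>\<^bsub>dP_O_mod2 n\<^esub>"
      by (simp_all add: kernel_def)
    then show "dP_rho n x = dP_rho n f"
      unfolding k(2) using f by (simp only: hom_mult hom_closed H.l_one)
  qed
  show ?thesis
    by (rule bexI[OF _ iso]) (simp add: coset)
qed

end
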